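(* Let $g\in\mathcal{M}(\mathbb{R})$, $g\ne0$, and let $a=\delta_{x_1=0}\otimes g\in\mathcal{M}(\mathbb{R}^2)$. Suppose that the Cauchy problem for the two-dimensional Burgers equation with datum $a$ admits a unique admissible solution $u$ (thus a self-similar one), and that $u$ is the limit of solutions $u_m(t)=S_ta_m$ associated with approximate data $a_m$ of $a$. In addition, assume that $g\ge0$ and that its support is bounded below (that is, $\inf\,{\rm Supp}(g)>-\infty$). Then this support is unbounded above: $$\sup\,{\rm Supp}(g)=+\infty.$$
   Context: The two-dimensional Burgers equation is $$\partial_tu+\partial_1\frac{u^2}2+\partial_2\frac{u^3}3=0,\qquad t>0,\ x\in\mathbb{R}^2.$$ Write $f(u)=(u^2/2,u^3/3)$. $\mathcal{M}(\mathbb{R}^n)$ is the space of bounded (signed, finite) Radon measures with total variation norm $\|\cdot\|_{\mathcal M}$. $\delta_{x_1=0}\otimes g$ is the product measure: $\langle\delta_{x_1=0}\otimes g,\psi\rangle=\int\psi(0,x_2)\,dg(x_2)$. For $b\in L^1\cap L^\infty(\mathbb{R}^2)$, $S_tb:=u(t)$ denotes Kruzhkov's semigroup, that is, $u\in L^\infty(\mathbb{R}_+\times\mathbb{R}^2)\cap C(\mathbb{R}_+;L^1(\mathbb{R}^2))$ is the unique admissible (Kruzhkov entropy) solution with initial data $b$. It is known (Serre–Silvestre) that there is a universal constant $c_\infty<\infty$ with $\|S_tb\|_\infty\le c_\infty t^{-1/2}\|b\|_1^{1/4}$ for all $t>0$ and all $b\in L^1\cap L^\infty(\mathbb{R}^2)$.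 Entropy solution on $(0,\infty)\times\mathbb{R}^2$: a function $u$, bounded on $(\tau,\infty)\times\mathbb{R}^2$ for every $\tau>0$, satisfying $$\int_0^\infty\int_{\mathbb{R}^2}(u\,\partial_t\phi+f(u)\cdot\nabla_x\phi)\,dx\,dt=0\quad\text{for all }\phi\in C_c^\infty((0,\infty)\times\mathbb{R}^2),$$ and $$\int_0^\infty\int_{\mathbb{R}^2}\big(|u-k|\,\partial_t\phi+\mathrm{sgn}(u-k)(f(u)-f(k))\cdot\nabla_x\phi\big)\,dx\,dt\ge0$$ for all $k\in\mathbb{R}$ and all non-negative $\phi\in C_c^\infty((0,\infty)\times\mathbb{R}^2)$. Admissible solution with datum $a\in\mathcal{M}(\mathbb{R}^2)$: an entropy solution $u\in L^\infty(0,\infty;L^1(\mathbb{R}^2))$ on $(0,\infty)\times\mathbb{R}^2$ such that $u(t)\to a$ in the narrow sense as $t\to0+$ (for the essential limit in $t$), i.e. $\int u(t,x)\psi(x)\,dx\to\langle a,\psi\rangle$ for every bounded continuous $\psi$. Self-similar: $u$ is self-similar if for every $\mu>0$, $\sqrt\mu\,u(\mu t,\sqrt\mu\,x_1,x_2)=u(t,x_1,x_2)$ almost everywhere; equivalently $u(t,x)=t^{-1/2}W(x_1t^{-1/2},x_2)$ for some profile $W$. (The scaling $u\mapsto\sqrt\mu\,u(\mu t,\sqrt\mu\,x_1,x_2)$ maps entropy solutions to entropy solutions.) Approximate data of a measure $a$ supported by the vertical axis $\{x_1=0\}$: a sequence $a_m\in L^1\cap L^\infty(\mathbb{R}^2)$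 converging narrowly to $a$, with ${\rm Supp}\,a_m\subset[-\frac1m,\frac1m]\times\mathbb{R}$ and $\|a_m\|_1\le\|a\|_{\mathcal M}$. "Limit" of $u_m$ means limit in the sense of distributions on $(0,\infty)\times\mathbb{R}^2$ (in particular this covers pointwise almost everywhere limits). *)

theory Defs
  imports "HOL-Analysis.Analysis"
begin

text \<open>
  Points of \<open>\<real>\<^sup>2\<close> are pairs \<open>(x1, x2)\<close>, points of space-time are triples \<open>(t, x1, x2)\<close>.  Elements of
  \<open>L\<^sup>1\<close> and \<open>L\<^sup>\<infinity>\<close> are given by Borel representatives; all conditions on them, and equality of
  solutions, are meant almost everywhere.
\<close>

section \<open>Finite signed measures\<close>

text \<open>
  A finite signed Radon measure on a Euclidean space is the same thing as a real-valued countably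
  additive function on the Borel sets; only values on Borel sets matter.
\<close>

definition signed_measure :: "('a::topological_space set \<Rightarrow> real) \<Rightarrow> bool" where
  "signed_measure \<nu> \<longleftrightarrow> \<nu> {} = 0 \<and>
     (\<forall>A. range A \<subseteq> sets borel \<longrightarrow> disjoint_family A \<longrightarrow>
          (\<lambda>i::nat. \<nu> (A i)) sums \<nu> (\<Union>i. A i))"

definition nonneg_measure :: "('a::topological_space set \<Rightarrow> real) \<Rightarrow> bool" where
  "nonneg_measure \<nu> \<longleftrightarrow> (\<forall>A\<in>sets borel. 0 \<le> \<nu> A)"

definition nonzero_measure :: "('a::topological_space set \<Rightarrow> real) \<Rightarrow> bool" where
  "nonzero_measure \<nu> \<longleftrightarrow> (\<exists>A\<in>sets borel. \<nu> A \<noteq> 0)"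

text \<open>
  The Jordan decomposition: \<open>\<nu>\<^sup>+ A = sup {\<nu> B | B \<subseteq> A}\<close> and \<open>\<nu>\<^sup>- = (-\<nu>)\<^sup>+\<close>.  Negative values
  of \<open>\<nu> B\<close> are truncated to \<open>0\<close> by \<^const>\<open>ennreal\<close>, which does not affect the supremum, since
  \<open>B = {}\<close> is admitted.
\<close>

definition positive_variation :: "('a::topological_space set \<Rightarrow> real) \<Rightarrow> 'a measure" where
  "positive_variation \<nu> =
     measure_of UNIV (sets borel) (\<lambda>A. SUP B\<in>{B \<in> sets borel. B \<subseteq> A}. ennreal (\<nu> B))"

definition negative_variation :: "('a::topological_space set \<Rightarrow> real) \<Rightarrow> 'a measure" where
  "negative_variation \<nu> = positive_variation (\<lambda>A. - \<nu> A)"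

definition signed_integral :: "('a::topological_space set \<Rightarrow> real) \<Rightarrow> ('a \<Rightarrow> real) \<Rightarrow> real" where
  "signed_integral \<nu> \<psi> =
     (LINT x|positive_variation \<nu>. \<psi> x) - (LINT x|negative_variation \<nu>. \<psi> x)"

definition total_variation :: "('a::topological_space set \<Rightarrow> real) \<Rightarrow> real" where
  "total_variation \<nu> =
     measure (positive_variation \<nu>) UNIV + measure (negative_variation \<nu>) UNIV"

definition measure_support :: "('a::topological_space set \<Rightarrow> real) \<Rightarrow> 'a set" where
  "measure_support \<nu> =
     {x. \<forall>U. open U \<longrightarrow> x \<in> U \<longrightarrow>
        0 < emeasure (positive_variation \<nu>) U + emeasure (negative_variation \<nu>) U}"

text \<open>The product measure \<open>\<delta>\<^bsub>x1=0\<^esub> \<otimes> g\<close>, which integrates \<open>\<psi>\<close> to \<open>\<integral>\<psi>(0, x2) dg(x2)\<close>.\<close>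

definition axis_measure :: "(real set \<Rightarrow> real) \<Rightarrow> (real \<times> real) set \<Rightarrow> real" where
  "axis_measure g A = g {x2. (0, x2) \<in> A}"

section \<open>Test functions\<close>

text \<open>All iterated directional derivatives up to order \<open>k\<close> exist and are continuous.\<close>

fun C_k :: "nat \<Rightarrow> ('a::euclidean_space \<Rightarrow> real) \<Rightarrow> bool" where
  "C_k 0 \<phi> \<longleftrightarrow> continuous_on UNIV \<phi>"
| "C_k (Suc k) \<phi> \<longleftrightarrow>
     (\<forall>z. \<phi> differentiable (at z)) \<and> (\<forall>v. C_k k (\<lambda>z. frechet_derivative \<phi> (at z) v))"

definition half_space :: "(real \<times> real \<times> real) set" where
  "half_space = {0<..} \<times> UNIV"

definition test_function :: "(real \<times> real \<times> real \<Rightarrow> real) \<Rightarrow> bool" where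
  "test_function \<phi> \<longleftrightarrow> (\<forall>k. C_k k \<phi>) \<and>
     compact (closure {z. \<phi> z \<noteq> 0}) \<and> closure {z. \<phi> z \<noteq> 0} \<subseteq> half_space"

definition time_deriv :: "(real \<times> real \<times> real \<Rightarrow> real) \<Rightarrow> real \<times> real \<times> real \<Rightarrow> real" where
  "time_deriv \<phi> z = frechet_derivative \<phi> (at z) (1, 0, 0)"

definition space_grad :: "(real \<times> real \<times> real \<Rightarrow> real) \<Rightarrow> real \<times> real \<times> real \<Rightarrow> real \<times> real" where
  "space_grad \<phi> z =
     (frechet_derivative \<phi> (at z) (0, 1, 0), frechet_derivative \<phi> (at z) (0, 0, 1))"

section \<open>Solutions of the Burgers equation\<close>

definition flux :: "real \<Rightarrow> real \<times> real" where
  "flux s = (s\<^sup>2 / 2, s ^ 3 / 3)"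

definition entropy_solution :: "(real \<times> real \<times> real \<Rightarrow> real) \<Rightarrow> bool" where
  "entropy_solution u \<longleftrightarrow>
     set_borel_measurable lborel half_space u \<and>
     (\<forall>\<tau>>0. \<exists>C. AE z in lborel. \<tau> < fst z \<longrightarrow> \<bar>u z\<bar> \<le> C) \<and>
     (\<forall>\<phi>. test_function \<phi> \<longrightarrow>
        (LINT z:half_space|lborel.
           u z * time_deriv \<phi> z + flux (u z) \<bullet> space_grad \<phi> z) = 0) \<and>
     (\<forall>k \<phi>. test_function \<phi> \<longrightarrow> (\<forall>z. 0 \<le> \<phi> z) \<longrightarrow>
        (LINT z:half_space|lborel.
           \<bar>u z - k\<bar> * time_deriv \<phi> z
           + (sgn (u z - k) *\<^sub>R (flux (u z) - flux k)) \<bullet> space_grad \<phi> z) \<ge> 0)"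

text \<open>
  The filter \<open>inf (at_right 0) (ae_filter lborel)\<close> expresses the essential limit as \<open>t \<rightarrow> 0+\<close>:
  a property holds eventually iff, for some \<open>\<delta> > 0\<close>, it holds for almost every \<open>t \<in> (0, \<delta>)\<close>.
\<close>

definition admissible_solution ::
    "((real \<times> real) set \<Rightarrow> real) \<Rightarrow> (real \<times> real \<times> real \<Rightarrow> real) \<Rightarrow> bool" where
  "admissible_solution a u \<longleftrightarrow>
     entropy_solution u \<and>
     (\<exists>C. AE t in lborel. 0 < t \<longrightarrow>
        integrable lborel (\<lambda>x. u (t, x)) \<and> (LINT x|lborel. \<bar>u (t, x)\<bar>) \<le> C) \<and>
     (\<forall>\<psi>. continuous_on UNIV \<psi> \<longrightarrow> bounded (range \<psi>) \<longrightarrow>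
        ((\<lambda>t. LINT x|lborel. u (t, x) * \<psi> x) \<longlongrightarrow> signed_integral a \<psi>)
          (inf (at_right 0) (ae_filter lborel)))"

definition unique_admissible_solution ::
    "((real \<times> real) set \<Rightarrow> real) \<Rightarrow> (real \<times> real \<times> real \<Rightarrow> real) \<Rightarrow> bool" where
  "unique_admissible_solution a u \<longleftrightarrow>
     admissible_solution a u \<and>
     (\<forall>v. admissible_solution a v \<longrightarrow> (AE z in lborel. z \<in> half_space \<longrightarrow> v z = u z))"

definition L1_Linf :: "(real \<times> real \<Rightarrow> real) \<Rightarrow> bool" where
  "L1_Linf b \<longleftrightarrow> integrable lborel b \<and> (\<exists>C. AE x in lborel. \<bar>b x\<bar> \<le> C)"

text \<open>
  \<open>kruzhkov_solution b u\<close> says that \<open>u(t) = S\<^sub>t b\<close>: \<open>u\<close> is the entropy solution in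
  \<open>L\<^sup>\<infinity>(\<real>\<^sub>+ \<times> \<real>\<^sup>2) \<inter> C(\<real>\<^sub>+; L\<^sup>1(\<real>\<^sup>2))\<close> with \<open>u(0) = b\<close>.
\<close>

definition kruzhkov_solution ::
    "(real \<times> real \<Rightarrow> real) \<Rightarrow> (real \<times> real \<times> real \<Rightarrow> real) \<Rightarrow> bool" where
  "kruzhkov_solution b u \<longleftrightarrow>
     entropy_solution u \<and>
     (\<exists>C. AE z in lborel. z \<in> half_space \<longrightarrow> \<bar>u z\<bar> \<le> C) \<and>
     (\<forall>t\<ge>0. integrable lborel (\<lambda>x. u (t, x))) \<and>
     (\<forall>s\<ge>0. ((\<lambda>t. LINT x|lborel. \<bar>u (t, x) - u (s, x)\<bar>) \<longlongrightarrow> 0) (at s within {0..})) \<and>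
     (AE x in lborel. u (0, x) = b x)"

text \<open>The support of a function modulo null sets, i.e. of the distribution it defines.\<close>

definition ess_support :: "(real \<times> real \<Rightarrow> real) \<Rightarrow> (real \<times> real) set" where
  "ess_support b = {x. \<forall>U. open U \<longrightarrow> x \<in> U \<longrightarrow> \<not> (AE y in lborel. y \<in> U \<longrightarrow> b y = 0)}"

definition approximate_data ::
    "((real \<times> real) set \<Rightarrow> real) \<Rightarrow> (nat \<Rightarrow> real \<times> real \<Rightarrow> real) \<Rightarrow> bool" where
  "approximate_data a b \<longleftrightarrow>
     (\<forall>m\<ge>1. L1_Linf (b m) \<and>
        ess_support (b m) \<subseteq> {- 1 / real m .. 1 / real m} \<times> UNIV \<and>
        (LINT x|lborel. \<bar>b m x\<bar>) \<le> total_variation a) \<and>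
     (\<forall>\<psi>. continuous_on UNIV \<psi> \<longrightarrow> bounded (range \<psi>) \<longrightarrow>
        (\<lambda>m. LINT x|lborel. b m x * \<psi> x) \<longlonglongrightarrow> signed_integral a \<psi>)"

definition distributional_limit ::
    "(nat \<Rightarrow> real \<times> real \<times> real \<Rightarrow> real) \<Rightarrow> (real \<times> real \<times> real \<Rightarrow> real) \<Rightarrow> bool" where
  "distributional_limit u_seq u \<longleftrightarrow>
     (\<forall>\<phi>. test_function \<phi> \<longrightarrow>
        (\<lambda>m. LINT z:half_space|lborel. u_seq m z * \<phi> z)
          \<longlonglongrightarrow> (LINT z:half_space|lborel. u z * \<phi> z))"

end

theory Submission
  imports Defs
begin

text \<open>
  Uniqueness makes \<open>u\<close> self-similar, so every marginal \<open>t \<mapsto> \<integral>u(t,x) \<psi>(x\<^sub>2) dx\<close> is constant in time: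
  it agrees with its value at \<open>\<mu>t\<close> and has a limit as \<open>t \<rightarrow> 0\<close>.  Testing the equation against
  \<open>\<theta>(t) \<psi>(x\<^sub>2)\<close> then gives \<open>\<integral>\<integral>\<theta> u\<^sup>3/3 \<psi>' = 0\<close>.  On the other hand \<open>u \<ge> 0\<close>: the entropy
  inequality with \<open>k = 0\<close> minus the equation shows that \<open>\<integral>(\<bar>u\<^sub>m\<bar> - u\<^sub>m) dx\<close> does not increase, and
  at \<open>t = 0\<close> it is at most \<open>\<parallel>a\<parallel> - \<integral>a\<^sub>m\<close>, which tends to \<open>0\<close> because \<open>g \<ge> 0\<close>.  With \<open>\<psi>' > 0\<close> this
  forces \<open>u = 0\<close>, against \<open>\<integral>u(t,x) dx = g(\<real>) > 0\<close>.  The hypotheses are thus contradictory, and the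
  conclusion follows.
\<close>

section \<open>Test functions\<close>

text \<open>The weight \<open>\<theta>(t) \<psi>(x2)\<close> is not compactly supported in x and has
  to be reached through cut-offs. This is possible because on a time strip the solution is
  integrable and bounded, so that both flux components are integrable too; hence the systematic use
  of \<open>on_strip a b u\<close>. A weight without x1 makes the first flux component disappear in
  the limit, and it is also what the scaling u -> s u(s^2 t, s x1, x2) permits: this leaves x2 alone
  and preserves both the equation and a datum carried by the axis. The sign of u cannot be read off
  its narrow limit at t = 0, which does not control the negative part. It is inherited from the
  approximations, whose L1 norms and total masses are squeezed against the same number g(R). As they
  tend to u only as distributions, the bound on their negative parts is first tested against
  nonnegative smooth functions, and the sign almost everywhere is recovered afterwards from
  integrals over boxes. The time weight lives on [1,2], away from t = 0, where u may be
  unbounded.\<close>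

lemma C_k_SucI:
  fixes f :: "'a::euclidean_space \<Rightarrow> real"
  assumes "\<And>z. (f has_derivative f' z) (at z)" and "\<And>v. C_k k (\<lambda>z. f' z v)"
  shows "C_k (Suc k) f"
proof -
  have "frechet_derivative f (at z) = f' z" for z
    using frechet_derivative_at[OF assms(1)] by simp
  then show ?thesis
    using assms by (auto simp: differentiable_def)
qed

lemma C_k_Suc_has_derivative:
  assumes "C_k (Suc k) f"
  shows "(f has_derivative frechet_derivative f (at z)) (at z)"
  using assms frechet_derivative_works by auto

lemma C_k_SucD: "C_k (Suc k) f \<Longrightarrow> C_k k f"
proof (induction k arbitrary: f)
  case 0
  then show ?case
    by (auto intro!: continuous_at_imp_continuous_on differentiable_imp_continuous_within)
next
  case (Suc k)
  then show ?case
    by (metis C_k.simps(2))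
qed

lemma C_k_const: "C_k k (\<lambda>_. c)"
proof (induction k arbitrary: c)
  case (Suc k)
  show ?case by (rule C_k_SucI[where f' = "\<lambda>_ _. 0"]) (auto intro: Suc)
qed auto

lemma C_k_add: "C_k k f \<Longrightarrow> C_k k g \<Longrightarrow> C_k k (\<lambda>z. f z + g z)"
proof (induction k arbitrary: f g)
  case 0
  then show ?case by (auto intro: continuous_on_add)
next
  case (Suc k)
  show ?case
    by (rule C_k_SucI[OF has_derivative_add[OF C_k_Suc_has_derivative[OF Suc.prems(1)]
          C_k_Suc_has_derivative[OF Suc.prems(2)]]], rule Suc.IH)
      (use Suc.prems in auto)
qed

lemma C_k_mult: "C_k k f \<Longrightarrow> C_k k g \<Longrightarrow> C_k k (\<lambda>z. f z * g z)"
proof (induction k arbitrary: f g)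
  case 0
  then show ?case by (auto intro: continuous_on_mult)
next
  case (Suc k)
  show ?case
  proof (rule C_k_SucI[OF has_derivative_mult[OF C_k_Suc_has_derivative[OF Suc.prems(1)]
          C_k_Suc_has_derivative[OF Suc.prems(2)]]])
    fix v
    show "C_k k (\<lambda>z. f z * frechet_derivative g (at z) v + frechet_derivative f (at z) v * g z)"
      by (rule C_k_add; rule Suc.IH)
        (use Suc.prems C_k_SucD[OF Suc.prems(1)] C_k_SucD[OF Suc.prems(2)] in auto)
  qed
qed

text \<open>The derivative in direction v is again of the form h (L z + b), where h is the
  derivative of f in direction L v. The induction therefore has to generalise over f.\<close>

lemma C_k_compose_affine:
  fixes f :: "'b::euclidean_space \<Rightarrow> real" and L :: "'a::euclidean_space \<Rightarrow> 'b"
  assumes "bounded_linear L"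
  shows "C_k k f \<Longrightarrow> C_k k (\<lambda>z. f (L z + b))"
proof (induction k arbitrary: f)
  case 0
  then show ?case
    using continuous_on_compose2[of UNIV f UNIV "\<lambda>z. L z + b"]
      continuous_on_add[OF linear_continuous_on[OF assms] continuous_on_const]
    by simp
next
  case (Suc k)
  show ?case
  proof (rule C_k_SucI)
    fix z
    have "((\<lambda>z. L z + b) has_derivative L) (at z)"
      using has_derivative_add_const[OF bounded_linear_imp_has_derivative[OF assms]] .
    from diff_chain_at[OF this C_k_Suc_has_derivative[OF Suc.prems]]
    show "((\<lambda>z. f (L z + b)) has_derivative
        (\<lambda>v. frechet_derivative f (at (L z + b)) (L v))) (at z)"
      by (simp add: o_def)
  next
    fix v
    show "C_k k (\<lambda>z. frechet_derivative f (at (L z + b)) (L v))"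
      using Suc.prems by (intro Suc.IH[where f = "\<lambda>z. frechet_derivative f (at z) (L v)"]) simp
  qed
qed

definition smooth :: "('a::euclidean_space \<Rightarrow> real) \<Rightarrow> bool" where
  "smooth f \<longleftrightarrow> (\<forall>k. C_k k f)"

lemma smooth_const: "smooth (\<lambda>_. c)"
  and smooth_add: "smooth f \<Longrightarrow> smooth g \<Longrightarrow> smooth (\<lambda>z. f z + g z)"
  and smooth_mult: "smooth f \<Longrightarrow> smooth g \<Longrightarrow> smooth (\<lambda>z. f z * g z)"
  by (simp_all add: smooth_def C_k_const C_k_add C_k_mult)

lemma smooth_compose_affine: "bounded_linear L \<Longrightarrow> smooth f \<Longrightarrow> smooth (\<lambda>z. f (L z + b))"
  by (simp add: smooth_def C_k_compose_affine)

lemma smooth_affine: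
  fixes f :: "real \<Rightarrow> real"
  assumes "smooth f"
  shows "smooth (\<lambda>x. f (c * x + b))"
  by (rule smooth_compose_affine[OF bounded_linear_mult_right assms])

lemma smooth_diff:
  assumes "smooth f" "smooth g"
  shows "smooth (\<lambda>z. f z - g z)"
  using smooth_add[OF assms(1) smooth_mult[OF smooth_const[of "-1"] assms(2)]] by simp

lemma smooth_imp_continuous: "smooth f \<Longrightarrow> continuous_on UNIV f"
  unfolding smooth_def by (metis C_k.simps(1))

lemma smooth_has_derivative: "smooth f \<Longrightarrow> (f has_derivative frechet_derivative f (at z)) (at z)"
  unfolding smooth_def using C_k_Suc_has_derivative by blast

lemma smooth_frechet_derivative: "smooth f \<Longrightarrow> smooth (\<lambda>z. frechet_derivative f (at z) v)"
  unfolding smooth_def by (metis C_k.simps(2))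

lemma smooth_realD:
  fixes f :: "real \<Rightarrow> real"
  assumes "smooth f"
  shows "(f has_real_derivative deriv f x) (at x)" and "smooth (deriv f)"
proof -
  have D: "(f has_real_derivative frechet_derivative f (at x) 1) (at x)" for x
  proof -
    have "frechet_derivative f (at x) h = frechet_derivative f (at x) 1 * h" for h
      using linear_cmul[OF has_derivative_linear[OF smooth_has_derivative[OF assms, of x]], of h 1]
      by simp
    then have "frechet_derivative f (at x) = (*) (frechet_derivative f (at x) 1)"
      by (rule ext)
    with smooth_has_derivative[OF assms, of x] show ?thesis
      unfolding has_field_derivative_def by metis
  qed
  have deriv_eq: "deriv f = (\<lambda>x. frechet_derivative f (at x) 1)"
    by (rule ext) (rule DERIV_imp_deriv[OF D])
  show "(f has_real_derivative deriv f x) (at x)"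
    unfolding deriv_eq by (rule D)
  show "smooth (deriv f)"
    unfolding deriv_eq by (rule smooth_frechet_derivative[OF assms])
qed

lemma C_k_realI:
  fixes f :: "real \<Rightarrow> real"
  assumes "\<And>x. (f has_real_derivative f' x) (at x)" and "C_k k f'"
  shows "C_k (Suc k) f"
proof (rule C_k_SucI)
  show "(f has_derivative (\<lambda>v. f' x * v)) (at x)" for x
    using assms(1) has_field_derivative_def by blast
  show "C_k k (\<lambda>x. f' x * v)" for v
    by (intro C_k_mult assms C_k_const)
qed

section \<open>A smooth step function whose derivative is a bump on (1,2)\<close>

definition flat :: "nat \<Rightarrow> real \<Rightarrow> real" where
  "flat n x = (if 0 < x then exp (- (1 / x)) / x ^ n else 0)"

lemma flat_tendsto_0: "(flat n \<longlongrightarrow> 0) (at 0)"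
proof -
  have "((\<lambda>x. inverse x ^ n / exp (inverse x)) \<longlongrightarrow> (0::real)) (at_right 0)"
    by (rule filterlim_compose[OF tendsto_power_div_exp_0 filterlim_inverse_at_top_right])
  then have "(flat n \<longlongrightarrow> 0) (at_right 0)"
    by (rule Lim_transform_eventually)
      (simp add: flat_def eventually_at_filter exp_minus inverse_eq_divide power_one_over
        mult.commute)
  moreover have "(flat n \<longlongrightarrow> 0) (at_left 0)"
    by (rule Lim_transform_eventually[OF tendsto_const])
      (auto simp: flat_def eventually_at_filter)
  ultimately show ?thesis by (simp add: filterlim_split_at)
qed

text \<open>The functions exp(-1/x) / x^n, extended by 0, are closed under differentiation up to
  linear combinations. Smoothness of all of them then follows by one induction on the order, with n
  arbitrary.\<close>

lemma flat_has_derivative: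
  "(flat n has_real_derivative flat (n + 2) x - real n * flat (n + 1) x) (at x)"
proof -
  consider "x < 0" | "x = 0" | "x > 0" by linarith
  then show ?thesis
  proof cases
    case 1
    have "((\<lambda>_. 0) has_real_derivative 0) (at x)" by simp
    then have "(flat n has_real_derivative 0) (at x)"
      by (rule has_field_derivative_transform_within_open[where S = "{..<0}"])
        (use 1 in \<open>auto simp: flat_def\<close>)
    then show ?thesis using 1 by (simp add: flat_def)
  next
    case 2
    \<comment> \<open>The difference quotient of \<open>flat n\<close> at 0 is
      \<open>flat (n + 1)\<close>, so the derivative there is the limit already computed.\<close>
    have "(\<lambda>y. (flat n y - flat n 0) / (y - 0)) = flat (n + 1)"
      by (auto simp: flat_def fun_eq_iff)
    then have "(flat n has_real_derivative 0) (at 0)"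
      using flat_tendsto_0[of "n + 1"] by (simp add: has_field_derivative_iff)
    then show ?thesis using 2 by (simp add: flat_def)
  next
    case 3
    have e: "((\<lambda>x. exp (- (1 / x))) has_real_derivative exp (- (1 / x)) * (1 / x\<^sup>2)) (at x)"
    proof (rule DERIV_fun_exp)
      have "((\<lambda>x. inverse x) has_real_derivative - (inverse x ^ Suc (Suc 0))) (at x)"
        using 3 by (intro DERIV_inverse) simp
      from DERIV_minus[OF this]
      show "((\<lambda>x. - (1 / x)) has_real_derivative 1 / x\<^sup>2) (at x)"
        by (simp add: inverse_eq_divide power2_eq_square)
    qed
    have "((\<lambda>x. exp (- (1 / x)) / x ^ n) has_real_derivative
        (exp (- (1 / x)) * (1 / x\<^sup>2) * x ^ n - exp (- (1 / x)) * (real n * x ^ (n - Suc 0))) / (x ^ n * x ^ n)) (at x)"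
      using 3 by (intro DERIV_divide e DERIV_pow) simp
    \<comment> \<open>The truncated exponent \<open>n - Suc 0\<close> is wrong only for n = 0, where
      the factor \<open>real n\<close> removes the term; hence the case split on n.\<close>
    also have "(exp (- (1 / x)) * (1 / x\<^sup>2) * x ^ n - exp (- (1 / x)) * (real n * x ^ (n - Suc 0))) / (x ^ n * x ^ n)
      = flat (n + 2) x - real n * flat (n + 1) x"
      using 3 by (cases n) (simp_all add: flat_def diff_divide_distrib power2_eq_square)
    finally have "((\<lambda>x. exp (- (1 / x)) / x ^ n) has_real_derivative
        flat (n + 2) x - real n * flat (n + 1) x) (at x)" .
    then show ?thesis
      by (rule has_field_derivative_transform_within_open[where S = "{0<..}"])
        (use 3 in \<open>auto simp: flat_def\<close>)
  qed
qed

lemma smooth_flat: "smooth (flat n)"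
proof -
  have "C_k k (flat n)" for k
  proof (induction k arbitrary: n)
    case 0
    have "continuous_on UNIV (flat n)"
      by (rule DERIV_continuous_on, rule has_field_derivative_at_within, rule flat_has_derivative)
    then show ?case by simp
  next
    case (Suc k)
    show ?case
    proof (rule C_k_realI[OF flat_has_derivative])
      show "C_k k (\<lambda>x. flat (n + 2) x - real n * flat (n + 1) x)"
        using C_k_add[OF Suc.IH[of "n + 2"] C_k_mult[OF C_k_const[of _ "- real n"] Suc.IH[of "n + 1"]]]
        by simp
    qed
  qed
  then show ?thesis by (simp add: smooth_def)
qed

text \<open>P is a normalised primitive of the bump exp(-1/(x-1)) exp(-1/(2-x)) on (1,2). P supplies
  all cut-offs, and B serves as the weight in time. Placing the transition in [1,2] keeps the
  support of B away from t = 0 and makes \<open>P (n * y)\<close> converge to the indicator of y >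
  0.\<close>

lemma smooth_step_exists:
  obtains P B :: "real \<Rightarrow> real"
  where "smooth P" "smooth B" "\<And>x. (P has_real_derivative B x) (at x)"
    "\<And>x. x \<le> 1 \<Longrightarrow> P x = 0" "\<And>x. x \<ge> 2 \<Longrightarrow> P x = 1"
    "\<And>x. 1 < x \<Longrightarrow> x < 2 \<Longrightarrow> B x > 0" "\<And>x. \<not> (1 < x \<and> x < 2) \<Longrightarrow> B x = 0"
proof -
  define b where "b x = flat 0 (x - 1) * flat 0 (2 - x)" for x
  have sb: "smooth b"
    using smooth_mult[OF smooth_affine[OF smooth_flat[of 0], of 1 "-1"]
        smooth_affine[OF smooth_flat[of 0], of "-1" 2]]
    by (simp add: b_def[abs_def])
  have "isCont b x" for x
    using smooth_imp_continuous[OF sb] by (simp add: continuous_on_eq_continuous_at)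
  then obtain F where F: "\<And>x. (F has_vector_derivative b x) (at x)"
    using einterval_antiderivative[of "-\<infinity>" \<infinity> b] by auto
  then have F: "\<And>x. (F has_real_derivative b x) (at x)"
    by (simp add: has_real_derivative_iff_has_vector_derivative)
  have bpos: "b x > 0" if "1 < x" "x < 2" for x using that by (simp add: b_def flat_def)
  have bzero: "b x = 0" if "\<not> (1 < x \<and> x < 2)" for x using that by (auto simp: b_def flat_def)
  have contF: "continuous_on A F" for A
    by (rule DERIV_continuous_on, rule has_field_derivative_at_within, rule F)
  have F0: "(F has_real_derivative 0) (at x)" if "\<not> (1 < x \<and> x < 2)" for x
    using F[of x] bzero[OF that] by simp
  have left: "F x = F 1" if "x \<le> 1" for x
  proof (cases "x = 1")
    case False
    then show ?thesis
      by (intro DERIV_isconst_end[of x 1 F, symmetric] contF F0) (use that in auto)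
  qed simp
  have right: "F x = F 2" if "x \<ge> 2" for x
  proof (cases "x = 2")
    case False
    then show ?thesis
      by (intro DERIV_isconst_end[of 2 x F] contF F0) (use that in auto)
  qed simp
  \<comment> \<open>The normalising constant is positive, being a value of the bump inside (1,2) by
    the mean value theorem.\<close>
  obtain z where "1 < z" "z < 2" "F 2 - F 1 = b z"
    using MVT2[of 1 2 F b] F by force
  then have c: "F 2 - F 1 > 0" using bpos by simp
  define P where "P x = (F x - F 1) / (F 2 - F 1)" for x
  define B where "B x = (1 / (F 2 - F 1)) * b x" for x
  have PB: "(P has_real_derivative B x) (at x)" for x
    using DERIV_cdivide[OF DERIV_diff[OF F DERIV_const], of "F 1" "F 2 - F 1" x]
    by (simp add: P_def[abs_def] B_def)
  have "smooth B" unfolding B_def[abs_def] by (intro smooth_mult smooth_const sb)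
  moreover have "smooth P" unfolding smooth_def
  proof
    fix k show "C_k k P"
      by (rule C_k_SucD[OF C_k_realI[OF PB]]) (use \<open>smooth B\<close> in \<open>simp add: smooth_def\<close>)
  qed
  ultimately have PB_smooth: "smooth P" "smooth B" by auto
  show ?thesis
  proof (rule that[OF PB_smooth PB])
    show "P x = 0" if "x \<le> 1" for x using left[OF that] by (simp add: P_def)
    show "P x = 1" if "x \<ge> 2" for x using right[OF that] c by (simp add: P_def)
    show "B x > 0" if "1 < x" "x < 2" for x using bpos[OF that] c by (simp add: B_def)
    show "B x = 0" if "\<not> (1 < x \<and> x < 2)" for x using bzero[OF that] by (simp add: B_def)
  qed
qed

section \<open>Lebesgue measure: positivity from boxes and dilations\<close>

lemma emeasure_le_of_boxes:
  fixes M N :: "'a::euclidean_space measure"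
  assumes sets: "sets M = sets borel" "sets N = sets borel"
    and fin: "emeasure N UNIV \<noteq> \<infinity>"
    and ac: "absolutely_continuous lborel M" "absolutely_continuous lborel N"
    and box: "\<And>a b. emeasure M (box a b) \<le> emeasure N (box a b)"
    and B: "B \<in> sets borel" "B \<subseteq> box a b"
  shows "emeasure M B \<le> emeasure N B"
proof -
  have open_le: "emeasure M U \<le> emeasure N U" if U: "open U" "U \<subseteq> box a b" "U \<noteq> {}" for U
  proof -
    \<comment> \<open>This gauge forces every box of the covering to stay inside U.\<close>
    obtain g where g: "gauge g" "\<And>x. x \<in> U \<Longrightarrow> g x \<subseteq> U"
    proof
      show "gauge (\<lambda>x. if x \<in> U then U else UNIV)"
        using U(1) by (auto simp: gauge_def)
    qed auto
    have "U \<subseteq> cbox a b" "box a b \<noteq> {}" using U box_subset_cbox by blast+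
    from covering_lemma[OF this g(1)] obtain \<D> where \<D>: "countable \<D>"
      "\<And>K. K \<in> \<D> \<Longrightarrow> interior K \<noteq> {} \<and> (\<exists>c d. K = cbox c d)"
      "pairwise (\<lambda>A B. interior A \<inter> interior B = {}) \<D>"
      "\<And>K. K \<in> \<D> \<Longrightarrow> \<exists>x \<in> U \<inter> K. K \<subseteq> g x" "U \<subseteq> \<Union>\<D>"
      by (metis (no_types, lifting))
    \<comment> \<open>V differs from U only by points on the boundaries of countably many boxes.
      These are Lebesgue null, hence null for M and N by absolute continuity.\<close>
    define V where "V = (\<Union>K\<in>\<D>. interior K)"
    have "open V" unfolding V_def by (intro open_UN) auto
    have VU: "V \<subseteq> U"
      using \<D>(4) g(2) interior_subset unfolding V_def by blast
    have "U - V \<subseteq> (\<Union>K\<in>\<D>. K - interior K)"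
      using \<D>(5) by (auto simp: V_def)
    moreover have "(\<Union>K\<in>\<D>. K - interior K) \<in> null_sets lborel"
    proof (rule null_sets_UN'[OF \<D>(1)])
      fix K assume "K \<in> \<D>"
      then obtain c d where K: "K = cbox c d" using \<D>(2) by blast
      show "K - interior K \<in> null_sets lborel"
      proof (rule null_setsI)
        show "emeasure lborel (K - interior K) = 0"
          unfolding K interior_cbox
          by (subst emeasure_Diff) (auto simp: emeasure_lborel_cbox_eq emeasure_lborel_box_eq box_subset_cbox inner_diff_left split: if_splits)
      qed (simp add: K)
    qed
    ultimately have "U - V \<in> null_sets lborel"
      by (rule null_sets_subset[rotated 2]) (use \<open>open V\<close> U(1) in auto)
    then have null: "U - V \<in> null_sets M" "U - V \<in> null_sets N"
      using ac by (auto simp: absolutely_continuous_def)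
    have eq: "emeasure L U = (\<integral>\<^sup>+K. emeasure L (interior K) \<partial>count_space \<D>)"
      if "sets L = sets borel" "U - V \<in> null_sets L" for L
    proof -
      have "U = V \<union> (U - V)" using VU by auto
      moreover have "V \<in> sets L" using \<open>open V\<close> that(1) by simp
      ultimately have "emeasure L U = emeasure L V"
        using emeasure_Un_null_set[OF _ that(2), of V] by metis
      also have "\<dots> = (\<integral>\<^sup>+K. emeasure L (interior K) \<partial>count_space \<D>)"
        unfolding V_def
        by (rule emeasure_UN_countable) (use \<D> that in \<open>auto simp: disjoint_family_on_def pairwise_def\<close>)
      finally show ?thesis .
    qed
    show ?thesis
      unfolding eq[OF sets(1) null(1)] eq[OF sets(2) null(2)]
    proof (rule nn_integral_mono)
      fix K assume "K \<in> space (count_space \<D>)"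
      then obtain c d where "K = cbox c d" using \<D>(2)[of K] by fastforce
      then show "emeasure M (interior K) \<le> emeasure N (interior K)"
        using box by (simp add: interior_cbox)
    qed
  qed
  have "emeasure N B = (INF U\<in>{U. B \<subseteq> U \<and> open U}. emeasure N U)"
    by (rule outer_regular) (use sets fin B sets_eq_imp_space_eq[OF sets(2)] in auto)
  also have "\<dots> \<ge> emeasure M B"
  proof (rule INF_greatest)
    fix U assume U: "U \<in> {U. B \<subseteq> U \<and> open U}"
    have "emeasure M B \<le> emeasure M (U \<inter> box a b)"
      by (rule emeasure_mono) (use U B sets in auto)
    also have "\<dots> \<le> emeasure N (U \<inter> box a b)"
      by (cases "U \<inter> box a b = {}") (use U in \<open>auto intro!: open_le\<close>)
    also have "\<dots> \<le> emeasure N U"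
      by (rule emeasure_mono) (use U sets in auto)
    finally show "emeasure M B \<le> emeasure N U" .
  qed
  finally show ?thesis .
qed

text \<open>M and N have the negative and the positive part of f as densities, since
  \<open>ennreal\<close> truncates at 0. The hypothesis says that M is at most N on boxes, hence on
  bounded Borel sets; on {f < 0} the measure N vanishes, and so M vanishes there as well.\<close>

lemma AE_nonneg_of_box_integrals:
  fixes f :: "'a::euclidean_space \<Rightarrow> real"
  assumes f: "integrable lborel f"
    and box: "\<And>a b. 0 \<le> (\<integral>x. indicator (box a b) x * f x \<partial>lborel)"
  shows "AE x in lborel. 0 \<le> f x"
proof -
  have [measurable]: "f \<in> borel_measurable borel" using f by auto
  define M where "M = density lborel (\<lambda>x. ennreal (- f x))"
  define N where "N = density lborel (\<lambda>x. ennreal (f x))"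
  have int_pos: "integrable lborel (\<lambda>x. max 0 (f x))" "integrable lborel (\<lambda>x. max 0 (- f x))"
    using f by auto
  have nn: "(\<integral>\<^sup>+x. ennreal (g x) * indicator A x \<partial>lborel) = ennreal (\<integral>x. indicator A x * max 0 (g x) \<partial>lborel)"
    if "A \<in> sets borel" "integrable lborel (\<lambda>x. max 0 (g x))" for A and g :: "'a \<Rightarrow> real"
  proof -
    have "(\<integral>\<^sup>+x. ennreal (g x) * indicator A x \<partial>lborel) = (\<integral>\<^sup>+x. ennreal (indicator A x * max 0 (g x)) \<partial>lborel)"
      by (intro nn_integral_cong) (auto split: split_indicator simp: max_def ennreal_neg)
    also have "\<dots> = ennreal (\<integral>x. indicator A x * max 0 (g x) \<partial>lborel)"
      using that integrable_mult_indicator[of A lborel "\<lambda>x. max 0 (g x)"]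
      by (intro nn_integral_eq_integral) auto
    finally show ?thesis .
  qed
  have fin: "emeasure N UNIV \<noteq> \<infinity>"
    using nn[of UNIV f] int_pos by (simp add: N_def emeasure_density)
  have le: "emeasure M (box a b) \<le> emeasure N (box a b)" for a b
  proof -
    have "(\<integral>x. indicator (box a b) x * max 0 (f x) \<partial>lborel) - (\<integral>x. indicator (box a b) x * max 0 (- f x) \<partial>lborel)
      = (\<integral>x. indicator (box a b) x * f x \<partial>lborel)"
    proof (subst Bochner_Integration.integral_diff[symmetric])
      show "integrable lborel (\<lambda>x. indicator (box a b) x * max 0 (f x))"
        "integrable lborel (\<lambda>x. indicator (box a b) x * max 0 (- f x))"
        using integrable_mult_indicator[of "box a b" lborel, OF _ int_pos(1)]
          integrable_mult_indicator[of "box a b" lborel, OF _ int_pos(2)] by simp_all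
    qed (auto intro!: Bochner_Integration.integral_cong simp: max_def split: split_indicator)
    then show ?thesis
      using box[of a b] nn[of "box a b"] int_pos
      by (simp add: M_def N_def emeasure_density ennreal_leI)
  qed
  have "AE x in lborel. x \<in> box (- real n *\<^sub>R One) (real n *\<^sub>R One) \<longrightarrow> 0 \<le> f x" for n
  proof -
    \<comment> \<open>The comparison is available for bounded sets only; the boxes exhaust the space
      as n grows.\<close>
    define B where "B = {x. f x < 0} \<inter> box (- real n *\<^sub>R One) (real n *\<^sub>R One)"
    have [measurable]: "B \<in> sets borel" by (simp add: B_def)
    have "emeasure M B \<le> emeasure N B"
      by (rule emeasure_le_of_boxes[OF _ _ fin _ _ le])
        (auto simp: M_def N_def absolutely_continuousI_density B_def)
    also have "emeasure N B = 0"
    proof -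
      have "(\<integral>\<^sup>+x. ennreal (f x) * indicator B x \<partial>lborel) = (\<integral>\<^sup>+x. 0 \<partial>(lborel :: 'a measure))"
        by (intro nn_integral_cong) (auto simp: B_def ennreal_neg split: split_indicator)
      then show ?thesis by (simp add: N_def emeasure_density)
    qed
    finally have "(\<integral>\<^sup>+x. ennreal (- f x) * indicator B x \<partial>lborel) = 0"
      by (simp add: M_def emeasure_density)
    then have "AE x in lborel. ennreal (- f x) * indicator B x = 0"
      by (subst (asm) nn_integral_0_iff_AE) auto
    then show ?thesis
      by eventually_elim (auto simp: B_def indicator_def ennreal_eq_0_iff split: if_splits)
  qed
  then have "AE x in lborel. \<forall>n. x \<in> box (- real n *\<^sub>R One) (real n *\<^sub>R One) \<longrightarrow> 0 \<le> f x"
    by (subst AE_all_countable) blast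
  then show ?thesis
  proof eventually_elim
    case (elim x)
    have "x \<in> (\<Union>n. box (- real n *\<^sub>R One) (real n *\<^sub>R One))"
      using UN_box_eq_UNIV[where 'a = 'a] by simp
    with elim show ?case by auto
  qed
qed

lemma deriv_lborel_integral:
  fixes F :: "real \<Rightarrow> real"
  assumes F: "\<And>x. (F has_real_derivative f x) (at x)" and cont: "continuous_on UNIV f"
    and supp: "\<And>x. x \<notin> {a..b} \<Longrightarrow> f x = 0" and "a \<le> b"
  shows "integrable lborel f" and "(\<integral>x. f x \<partial>lborel) = F b - F a"
proof -
  have "has_bochner_integral lborel (\<lambda>x. f x * indicator {a .. b} x) (F b - F a)"
    by (rule has_bochner_integral_FTC_Icc_real)
      (use assms in \<open>auto simp: continuous_on_eq_continuous_at\<close>)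
  also have "(\<lambda>x. f x * indicator {a .. b} x) = f"
    using supp by (auto simp: fun_eq_iff split: split_indicator)
  finally show "integrable lborel f" "(\<integral>x. f x \<partial>lborel) = F b - F a"
    by (auto simp: has_bochner_integral_iff)
qed

text \<open>Change of variables in abstract form, with c the Jacobian of T. One pair of transfer
  lemmas then serves the dilations of the time axis, of the plane and of space-time.\<close>

definition scaling :: "real \<Rightarrow> ('a::euclidean_space \<Rightarrow> 'a) \<Rightarrow> bool" where
  "scaling c T \<longleftrightarrow> 0 < c \<and> T \<in> borel_measurable borel \<and>
     lborel = density (distr lborel borel T) (\<lambda>_. ennreal c)"

lemma scaling_AE:
  assumes "scaling c T" and Q: "AE z in lborel. Q z"
  shows "AE z in lborel. Q (T z)"
proof -
  have T[measurable]: "T \<in> borel_measurable borel" and c: "c > 0"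
    and eq: "lborel = density (distr lborel borel T) (\<lambda>_. ennreal c)"
    using assms(1) by (auto simp: scaling_def)
  have "AE z in density (distr lborel borel T) (\<lambda>_. ennreal c). Q z"
    by (subst eq[symmetric]) (rule Q)
  then have "AE z in distr lborel borel T. Q z"
    using c by (simp add: AE_density)
  then show ?thesis by (rule AE_distrD[rotated]) simp
qed

lemma scaling_integral:
  fixes f :: "'a::euclidean_space \<Rightarrow> real"
  assumes "scaling c T" and f[measurable]: "f \<in> borel_measurable borel"
  shows "(\<integral>z. f z \<partial>lborel) = c * (\<integral>z. f (T z) \<partial>lborel)"
    and "integrable lborel (\<lambda>z. f (T z)) \<longleftrightarrow> integrable lborel f"
proof -
  have T[measurable]: "T \<in> borel_measurable borel" and c: "c > 0"
    and eq: "lborel = density (distr lborel borel T) (\<lambda>_. ennreal c)"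
    using assms(1) by (auto simp: scaling_def)
  show "(\<integral>z. f z \<partial>lborel) = c * (\<integral>z. f (T z) \<partial>lborel)"
    using c by (subst eq) (simp add: integral_density integral_distr)
  show "integrable lborel (\<lambda>z. f (T z)) \<longleftrightarrow> integrable lborel f"
    using c by (subst (2) eq) (simp add: integrable_density integrable_distr_eq)
qed

lemma scaling_diagonal:
  fixes c :: "'a::euclidean_space \<Rightarrow> real"
  assumes "\<And>j. j \<in> Basis \<Longrightarrow> c j > 0"
  shows "scaling (\<Prod>j\<in>Basis. c j) (\<lambda>x. \<Sum>j\<in>Basis. (c j * (x \<bullet> j)) *\<^sub>R j)"
  unfolding scaling_def
proof (intro conjI)
  show "(\<lambda>x::'a. \<Sum>j\<in>Basis. (c j * (x \<bullet> j)) *\<^sub>R j) \<in> borel_measurable borel" by measurable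
  show "(\<Prod>j\<in>Basis. c j) > 0" by (intro prod_pos assms)
  have "(\<Prod>j\<in>Basis. \<bar>c j\<bar>) = (\<Prod>j\<in>Basis. c j)"
    by (intro prod.cong refl) (use assms in force)
  then show "lborel = density (distr lborel borel (\<lambda>x. \<Sum>j\<in>Basis. (c j * (x \<bullet> j)) *\<^sub>R j))
      (\<lambda>_. ennreal (\<Prod>j\<in>Basis. c j))"
    using lborel_affine_euclidean[of c 0] assms by force
qed

lemma scaling_real: "s > 0 \<Longrightarrow> scaling s (\<lambda>t::real. s * t)"
  using scaling_diagonal[of "\<lambda>_::real. s"] by simp

lemma scaling_plane:
  assumes "s > 0"
  shows "scaling s (\<lambda>x::real \<times> real. (s * fst x, snd x))"
proof -
  let ?c = "\<lambda>j::real \<times> real. if fst j = 0 then 1 else s"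
  have B: "(Basis :: (real \<times> real) set) = {(1, 0), (0, 1)}"
    by (auto simp: Basis_prod_def)
  have "(\<Sum>j\<in>Basis. (?c j * (x \<bullet> j)) *\<^sub>R j) = (s * fst x, snd x)" for x :: "real \<times> real"
    by (simp add: B inner_prod_def)
  moreover have "(\<Prod>j\<in>Basis. ?c j) = s" by (simp add: B)
  ultimately show ?thesis
    using scaling_diagonal[of ?c] \<open>s > 0\<close> by simp
qed

lemma scaling_spacetime:
  assumes "s > 0" "r > 0"
  shows "scaling (r * s) (\<lambda>z::real \<times> real \<times> real. (r * fst z, s * fst (snd z), snd (snd z)))"
proof -
  let ?c = "\<lambda>j::real \<times> real \<times> real. if fst j \<noteq> 0 then r else if fst (snd j) \<noteq> 0 then s else 1"
  have B: "(Basis :: (real \<times> real \<times> real) set) = {(1, 0, 0), (0, 1, 0), (0, 0, 1)}"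
    by (auto simp: Basis_prod_def zero_prod_def)
  have "(\<Sum>j\<in>Basis. (?c j * (x \<bullet> j)) *\<^sub>R j) = (r * fst x, s * fst (snd x), snd (snd x))"
    for x :: "real \<times> real \<times> real"
    by (simp add: B inner_prod_def)
  moreover have "(\<Prod>j\<in>Basis. ?c j) = r * s" by (simp add: B)
  ultimately show ?thesis
    using scaling_diagonal[of ?c] \<open>s > 0\<close> \<open>r > 0\<close> by simp
qed

section \<open>Tensor products and cut-offs\<close>

definition tensor :: "(real \<Rightarrow> real) \<Rightarrow> (real \<Rightarrow> real) \<Rightarrow> (real \<Rightarrow> real) \<Rightarrow> real \<times> real \<times> real \<Rightarrow> real" where
  "tensor \<alpha> \<beta> \<gamma> z = \<alpha> (fst z) * \<beta> (fst (snd z)) * \<gamma> (snd (snd z))"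

lemma smooth_tensor:
  assumes "smooth \<alpha>" "smooth \<beta>" "smooth \<gamma>"
  shows "smooth (tensor \<alpha> \<beta> \<gamma>)"
proof -
  have L: "bounded_linear (\<lambda>z::real \<times> real \<times> real. fst z)"
    "bounded_linear (\<lambda>z::real \<times> real \<times> real. fst (snd z))"
    "bounded_linear (\<lambda>z::real \<times> real \<times> real. snd (snd z))"
    by (intro bounded_linear_fst bounded_linear_snd bounded_linear_fst_comp bounded_linear_snd_comp)+
  show ?thesis
    unfolding tensor_def[abs_def]
    using smooth_mult[OF smooth_mult[OF smooth_compose_affine[OF L(1) assms(1), of 0]
          smooth_compose_affine[OF L(2) assms(2), of 0]] smooth_compose_affine[OF L(3) assms(3), of 0]]
    by simp
qed

lemma test_function_tensor:
  assumes "smooth \<alpha>" "smooth \<beta>" "smooth \<gamma>"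
    and "\<And>t. t \<notin> {a..b} \<Longrightarrow> \<alpha> t = 0" and "0 < a"
    and "\<And>x. x \<notin> {c..d} \<Longrightarrow> \<beta> x = 0" and "\<And>x. x \<notin> {c'..d'} \<Longrightarrow> \<gamma> x = 0"
  shows "test_function (tensor \<alpha> \<beta> \<gamma>)"
proof -
  define Q where "Q = {a..b} \<times> {c..d} \<times> {c'..d'}"
  have "compact Q" unfolding Q_def by (intro compact_Times compact_Icc)
  have "{z. tensor \<alpha> \<beta> \<gamma> z \<noteq> 0} \<subseteq> Q"
    using assms(4,6,7) unfolding Q_def tensor_def by fastforce
  then have cl: "closure {z. tensor \<alpha> \<beta> \<gamma> z \<noteq> 0} \<subseteq> Q"
    by (rule closure_minimal) (rule compact_imp_closed[OF \<open>compact Q\<close>])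
  then have "compact (closure {z. tensor \<alpha> \<beta> \<gamma> z \<noteq> 0})"
    using \<open>compact Q\<close> closed_closure by (metis compact_Int_closed inf.absorb_iff2)
  moreover have "Q \<subseteq> half_space"
    using \<open>0 < a\<close> by (auto simp: Q_def half_space_def)
  ultimately show ?thesis
    using cl smooth_tensor[OF assms(1-3)] by (auto simp: test_function_def smooth_def)
qed

lemma frechet_derivative_tensor:
  assumes "smooth \<alpha>" "smooth \<beta>" "smooth \<gamma>"
  shows "frechet_derivative (tensor \<alpha> \<beta> \<gamma>) (at z) =
    (\<lambda>h. tensor (deriv \<alpha>) \<beta> \<gamma> z * fst h + tensor \<alpha> (deriv \<beta>) \<gamma> z * fst (snd h)
       + tensor \<alpha> \<beta> (deriv \<gamma>) z * snd (snd h))"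
proof -
  have F: "((\<lambda>z. \<alpha> (fst z)) has_derivative (\<lambda>h. deriv \<alpha> (fst z) * fst h)) (at z)"
    "((\<lambda>z. \<beta> (fst (snd z))) has_derivative (\<lambda>h. deriv \<beta> (fst (snd z)) * fst (snd h))) (at z)"
    "((\<lambda>z. \<gamma> (snd (snd z))) has_derivative (\<lambda>h. deriv \<gamma> (snd (snd z)) * snd (snd h))) (at z)"
    using smooth_realD(1)[OF assms(1), of "fst z"] smooth_realD(1)[OF assms(2), of "fst (snd z)"]
      smooth_realD(1)[OF assms(3), of "snd (snd z)"]
    by (auto intro!: has_derivative_compose[where f = fst, OF has_derivative_fst[OF has_derivative_ident]]
        has_derivative_compose[where f = "\<lambda>z. fst (snd z)",
          OF has_derivative_fst[OF has_derivative_snd[OF has_derivative_ident]]]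
        has_derivative_compose[where f = "\<lambda>z. snd (snd z)",
          OF has_derivative_snd[OF has_derivative_snd[OF has_derivative_ident]]]
        simp: has_field_derivative_def)
  have "(tensor \<alpha> \<beta> \<gamma> has_derivative
    (\<lambda>h. tensor (deriv \<alpha>) \<beta> \<gamma> z * fst h + tensor \<alpha> (deriv \<beta>) \<gamma> z * fst (snd h)
       + tensor \<alpha> \<beta> (deriv \<gamma>) z * snd (snd h))) (at z)"
    unfolding tensor_def[abs_def]
    by (rule has_derivative_eq_rhs[OF has_derivative_mult[OF has_derivative_mult[OF F(1,2)] F(3)]])
      (simp add: fun_eq_iff algebra_simps)
  from frechet_derivative_at[OF this] show ?thesis by simp
qed

lemma time_deriv_tensor:
  assumes "smooth \<alpha>" "smooth \<beta>" "smooth \<gamma>"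
  shows "time_deriv (tensor \<alpha> \<beta> \<gamma>) z = tensor (deriv \<alpha>) \<beta> \<gamma> z"
  by (simp add: time_deriv_def frechet_derivative_tensor[OF assms])

lemma space_grad_tensor:
  assumes "smooth \<alpha>" "smooth \<beta>" "smooth \<gamma>"
  shows "space_grad (tensor \<alpha> \<beta> \<gamma>) z = (tensor \<alpha> (deriv \<beta>) \<gamma> z, tensor \<alpha> \<beta> (deriv \<gamma>) z)"
  by (simp add: space_grad_def frechet_derivative_tensor[OF assms])

lemma deriv_zero_outside:
  fixes f :: "real \<Rightarrow> real"
  assumes "\<And>x. x \<notin> {a..b} \<Longrightarrow> f x = 0" and "x \<notin> {a..b}"
  shows "deriv f x = 0"
proof -
  have "(f has_real_derivative 0) (at x)"
    by (rule has_field_derivative_transform_within_open[OF DERIV_const, where S = "- {a..b}"])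
      (use assms in \<open>auto simp: open_Compl\<close>)
  then show ?thesis by (rule DERIV_imp_deriv)
qed

lemma bounded_of_support:
  fixes f :: "real \<Rightarrow> real"
  assumes "continuous_on UNIV f" and "\<And>x. x \<notin> {a..b} \<Longrightarrow> f x = 0"
  obtains D where "D \<ge> 0" "\<And>x. \<bar>f x\<bar> \<le> D"
proof -
  have "bounded (f ` {a..b})"
    by (intro compact_imp_bounded compact_continuous_image continuous_on_subset[OF assms(1)]) auto
  then obtain D where D: "0 < D" "\<forall>y\<in>f ` {a..b}. norm y \<le> D"
    unfolding bounded_pos by blast
  have "\<bar>f x\<bar> \<le> D" for x
    using D assms(2)[of x] by (cases "x \<in> {a..b}") auto
  then show ?thesis using that[of D] D(1) by simp
qed

lemma borel_measurable_tensor[measurable]: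
  assumes [measurable]: "\<alpha> \<in> borel_measurable borel" "\<beta> \<in> borel_measurable borel" "\<gamma> \<in> borel_measurable borel"
  shows "tensor \<alpha> \<beta> \<gamma> \<in> borel_measurable borel"
proof -
  have [measurable]: "(\<lambda>z::real \<times> real \<times> real. fst z) \<in> borel_measurable borel"
    "(\<lambda>z::real \<times> real \<times> real. fst (snd z)) \<in> borel_measurable borel"
    "(\<lambda>z::real \<times> real \<times> real. snd (snd z)) \<in> borel_measurable borel"
    by (intro borel_measurable_continuous_onI continuous_intros)+
  show ?thesis unfolding tensor_def[abs_def] by measurable
qed

lemma tensor_bound:
  assumes "\<And>x. \<bar>\<alpha> x\<bar> \<le> A" "\<And>x. \<bar>\<beta> x\<bar> \<le> B" "\<And>x. \<bar>\<gamma> x\<bar> \<le> C"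
  shows "\<bar>tensor \<alpha> \<beta> \<gamma> z\<bar> \<le> A * B * C"
proof -
  have "0 \<le> A" "0 \<le> B" using assms(1,2) abs_ge_zero order_trans by blast+
  then show ?thesis
    unfolding tensor_def abs_mult by (intro mult_mono assms) auto
qed

lemma integrable_mult_bounded:
  fixes p h :: "'a \<Rightarrow> real"
  assumes "integrable M p" "h \<in> borel_measurable M" "\<And>z. \<bar>h z\<bar> \<le> D"
  shows "integrable M (\<lambda>z. p z * h z)"
proof (rule Bochner_Integration.integrable_bound)
  show "integrable M (\<lambda>z. D * \<bar>p z\<bar>)" using assms by auto
  have [measurable]: "p \<in> borel_measurable M" "h \<in> borel_measurable M" using assms by auto
  show "(\<lambda>z. p z * h z) \<in> borel_measurable M" by measurable
  show "AE z in M. norm (p z * h z) \<le> norm (D * \<bar>p z\<bar>)"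
  proof (rule AE_I2)
    fix z
    have "\<bar>p z\<bar> * \<bar>h z\<bar> \<le> \<bar>p z\<bar> * \<bar>D\<bar>"
      by (intro mult_left_mono) (use assms(3)[of z] in auto)
    then show "norm (p z * h z) \<le> norm (D * \<bar>p z\<bar>)" by (simp add: abs_mult mult.commute)
  qed
qed

lemma integral_mult_bounded_tendsto:
  fixes p h :: "'a \<Rightarrow> real" and g :: "nat \<Rightarrow> 'a \<Rightarrow> real"
  assumes p: "integrable M p" and g: "\<And>n. g n \<in> borel_measurable M" "\<And>n z. \<bar>g n z\<bar> \<le> D"
    and h: "\<And>z. (\<lambda>n. g n z) \<longlonglongrightarrow> h z"
  shows "(\<lambda>n. \<integral>z. p z * g n z \<partial>M) \<longlonglongrightarrow> (\<integral>z. p z * h z \<partial>M)"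
proof (rule integral_dominated_convergence)
  have [measurable]: "p \<in> borel_measurable M" "\<And>n. g n \<in> borel_measurable M" using p g by auto
  have [measurable]: "h \<in> borel_measurable M"
    by (rule borel_measurable_LIMSEQ_real[OF h]) measurable
  show "(\<lambda>z. p z * h z) \<in> borel_measurable M" "(\<lambda>z. p z * g n z) \<in> borel_measurable M" for n
    by measurable
  show "integrable M (\<lambda>z. D * \<bar>p z\<bar>)" using p by auto
  show "AE z in M. (\<lambda>n. p z * g n z) \<longlonglongrightarrow> p z * h z"
    by (intro AE_I2 tendsto_intros h)
  show "AE z in M. norm (p z * g n z) \<le> D * \<bar>p z\<bar>" for n
  proof (rule AE_I2)
    fix z
    have "\<bar>p z\<bar> * \<bar>g n z\<bar> \<le> \<bar>p z\<bar> * D"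
      by (intro mult_left_mono) (use g(2) in auto)
    then show "norm (p z * g n z) \<le> D * \<bar>p z\<bar>" by (simp add: abs_mult mult.commute)
  qed
qed

section \<open>Cut-offs built from the step, and their removal from integrals\<close>

locale smooth_step =
  fixes P B :: "real \<Rightarrow> real"
  assumes smooth_P: "smooth P" and smooth_B: "smooth B"
    and P_deriv: "\<And>x. (P has_real_derivative B x) (at x)"
    and P_left: "\<And>x. x \<le> 1 \<Longrightarrow> P x = 0" and P_right: "\<And>x. x \<ge> 2 \<Longrightarrow> P x = 1"
    and B_pos: "\<And>x. 1 < x \<Longrightarrow> x < 2 \<Longrightarrow> B x > 0"
    and B_zero: "\<And>x. \<not> (1 < x \<and> x < 2) \<Longrightarrow> B x = 0"
begin

lemma B_nonneg: "B x \<ge> 0"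
  using B_pos[of x] B_zero[of x] by fastforce

lemma P_mono: "x \<le> y \<Longrightarrow> P x \<le> P y"
  using P_deriv B_nonneg by (intro DERIV_nonneg_imp_nondecreasing[of x y P]) auto

lemma P_nonneg: "P x \<ge> 0"
  using P_mono[of "min x 1" x] P_left[of "min x 1"] by simp

lemma P_le_1: "P x \<le> 1"
  using P_mono[of x "max x 2"] P_right[of "max x 2"] by simp

lemma P_abs: "\<bar>P x\<bar> \<le> 1"
  using P_nonneg P_le_1 by simp

lemma B_support: "x \<notin> {1..2} \<Longrightarrow> B x = 0"
  using B_zero[of x] by force

lemma continuous_P: "continuous_on A P" and continuous_B: "continuous_on A B"
  using smooth_imp_continuous smooth_P smooth_B continuous_on_subset by blast+

lemma borel_measurable_P[measurable]: "P \<in> borel_measurable borel"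
  and borel_measurable_B[measurable]: "B \<in> borel_measurable borel"
  using continuous_P continuous_B by (auto intro: borel_measurable_continuous_onI)

lemma B_bounded: obtains K where "K \<ge> 0" "\<And>x. \<bar>B x\<bar> \<le> K"
  using bounded_of_support[OF continuous_B B_support] by blast

lemma P_affine_deriv: "((\<lambda>x. P (c * x + b)) has_real_derivative B (c * x + b) * c) (at x)"
  by (rule DERIV_chain2[OF P_deriv]) (auto intro!: derivative_eq_intros)

lemma integral_B: "integrable lborel B" "(\<integral>t. B t \<partial>lborel) = 1"
  using deriv_lborel_integral[OF P_deriv continuous_B B_support] P_left[of 1] P_right[of 2] by auto

text \<open>It equals 1 for |x| <= n - 2 and 0 for |x| >= n - 1. The step is translated and not
  stretched: its derivative is bounded uniformly in n and, at a fixed point, vanishes for large n,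
  which is all that dominated convergence requires.\<close>

definition cutoff :: "nat \<Rightarrow> real \<Rightarrow> real" where
  "cutoff n x = P (real n + x) * P (real n - x)"

lemma smooth_cutoff: "smooth (cutoff n)"
  using smooth_mult[OF smooth_affine[OF smooth_P, of 1 "real n"] smooth_affine[OF smooth_P, of "-1" "real n"]]
  by (simp add: cutoff_def[abs_def] algebra_simps)

lemma deriv_cutoff:
  "deriv (cutoff n) x = B (real n + x) * P (real n - x) - P (real n + x) * B (real n - x)"
  using DERIV_imp_deriv[OF DERIV_mult[OF P_affine_deriv[of 1 "real n" x] P_affine_deriv[of "-1" "real n" x]]]
  by (simp add: cutoff_def[abs_def] algebra_simps)

lemma cutoff_nonneg: "cutoff n x \<ge> 0" and cutoff_abs: "\<bar>cutoff n x\<bar> \<le> 1"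
  by (auto simp: cutoff_def P_nonneg P_le_1 mult_le_one)

lemma cutoff_support: "x \<notin> {- real n..real n} \<Longrightarrow> cutoff n x = 0"
  using P_left[of "real n + x"] P_left[of "real n - x"] by (auto simp: cutoff_def)

lemma deriv_cutoff_abs:
  assumes "\<And>x. \<bar>B x\<bar> \<le> K"
  shows "\<bar>deriv (cutoff n) x\<bar> \<le> 2 * K"
proof -
  have "\<bar>B (real n + x)\<bar> * \<bar>P (real n - x)\<bar> \<le> K * 1"
    by (intro mult_mono assms P_abs) (use assms[of 0] in auto)
  moreover have "\<bar>P (real n + x)\<bar> * \<bar>B (real n - x)\<bar> \<le> 1 * K"
    by (intro mult_mono assms P_abs) auto
  ultimately show ?thesis
    unfolding deriv_cutoff abs_mult[symmetric] by linarith
qed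

lemma cutoff_eventually:
  "\<forall>\<^sub>F n in sequentially. cutoff n x = 1" "\<forall>\<^sub>F n in sequentially. deriv (cutoff n) x = 0"
proof -
  have "\<forall>\<^sub>F n in sequentially. \<bar>x\<bar> + 2 \<le> real n"
    using eventually_ge_at_top[of "nat \<lceil>\<bar>x\<bar> + 2\<rceil>"] by eventually_elim linarith
  then have "\<forall>\<^sub>F n in sequentially. cutoff n x = 1 \<and> deriv (cutoff n) x = 0"
  proof eventually_elim
    case (elim n)
    then have "real n + x \<ge> 2" "real n - x \<ge> 2" by linarith+
    then show ?case by (simp add: cutoff_def deriv_cutoff P_right B_zero)
  qed
  then show "\<forall>\<^sub>F n in sequentially. cutoff n x = 1" "\<forall>\<^sub>F n in sequentially. deriv (cutoff n) x = 0"
    by (auto elim: eventually_mono)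
qed

lemma cutoff_tendsto: "(\<lambda>n. cutoff n x) \<longlonglongrightarrow> 1"
  and deriv_cutoff_tendsto: "(\<lambda>n. deriv (cutoff n) x) \<longlonglongrightarrow> 0"
  using cutoff_eventually by (auto intro: tendsto_eventually)

text \<open>The functions p1, p2, p3 stand for a density and its two fluxes; leaving them arbitrary
  lets the lemma serve both the equation and the entropy inequality. The p2 term has no limit
  contribution because the limiting weight does not depend on x1.\<close>

lemma cutoff_limit:
  fixes p1 p2 p3 :: "real \<times> real \<times> real \<Rightarrow> real"
  assumes p: "integrable lborel p1" "integrable lborel p2" "integrable lborel p3"
    and \<alpha>: "smooth \<alpha>" "\<And>x. \<bar>\<alpha> x\<bar> \<le> A" "\<And>x. \<bar>deriv \<alpha> x\<bar> \<le> A"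
    and \<psi>: "smooth \<psi>" "\<And>x. \<bar>\<psi> x\<bar> \<le> C" "\<And>x. \<bar>deriv \<psi> x\<bar> \<le> C"
  shows "(\<lambda>n. \<integral>z. p1 z * tensor (deriv \<alpha>) (cutoff n) (\<lambda>x. cutoff n x * \<psi> x) z
      + p2 z * tensor \<alpha> (deriv (cutoff n)) (\<lambda>x. cutoff n x * \<psi> x) z
      + p3 z * tensor \<alpha> (cutoff n) (deriv (\<lambda>x. cutoff n x * \<psi> x)) z \<partial>lborel)
    \<longlonglongrightarrow> (\<integral>z. p1 z * (deriv \<alpha> (fst z) * \<psi> (snd (snd z))) \<partial>lborel)
      + (\<integral>z. p3 z * (\<alpha> (fst z) * deriv \<psi> (snd (snd z))) \<partial>lborel)"
proof -
  obtain K where K: "K \<ge> 0" "\<And>x. \<bar>B x\<bar> \<le> K" using B_bounded by blast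
  have "C \<ge> 0" using \<psi>(2) abs_ge_zero order_trans by blast
  have d: "deriv (\<lambda>x. cutoff n x * \<psi> x) = (\<lambda>x. deriv (cutoff n) x * \<psi> x + deriv \<psi> x * cutoff n x)" for n
    using DERIV_imp_deriv[OF DERIV_mult[OF smooth_realD(1)[OF smooth_cutoff] smooth_realD(1)[OF \<psi>(1)]]]
    by auto
  have m: "f \<in> borel_measurable borel" if "smooth f" for f :: "real \<Rightarrow> real"
    using smooth_imp_continuous[OF that] by (rule borel_measurable_continuous_onI)
  note sm = \<alpha>(1) smooth_realD(2)[OF \<alpha>(1)] smooth_cutoff smooth_realD(2)[OF smooth_cutoff]
    smooth_mult[OF smooth_cutoff \<psi>(1)] smooth_realD(2)[OF smooth_mult[OF smooth_cutoff \<psi>(1)]]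
  have b1: "\<bar>cutoff n x * \<psi> x\<bar> \<le> 1 * C" for n x
    unfolding abs_mult by (intro mult_mono cutoff_abs \<psi>) auto
  have b2: "\<bar>deriv (\<lambda>x. cutoff n x * \<psi> x) x\<bar> \<le> 2 * K * C + C * 1" for n x
  proof -
    have "\<bar>deriv (cutoff n) x\<bar> * \<bar>\<psi> x\<bar> \<le> 2 * K * C"
      by (intro mult_mono deriv_cutoff_abs \<psi> K) (use K in auto)
    moreover have "\<bar>deriv \<psi> x\<bar> * \<bar>cutoff n x\<bar> \<le> C * 1"
      by (intro mult_mono cutoff_abs \<psi>) (use \<open>C \<ge> 0\<close> in auto)
    ultimately show ?thesis
      unfolding d abs_mult[symmetric] by linarith
  qed
  note bd1 = tensor_bound[OF \<alpha>(3) cutoff_abs b1]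
  note bd2 = tensor_bound[OF \<alpha>(2) deriv_cutoff_abs[OF K(2)] b1]
  note bd3 = tensor_bound[OF \<alpha>(2) cutoff_abs b2]
  have me: "tensor (deriv \<alpha>) (cutoff n) (\<lambda>x. cutoff n x * \<psi> x) \<in> borel_measurable lborel"
    "tensor \<alpha> (deriv (cutoff n)) (\<lambda>x. cutoff n x * \<psi> x) \<in> borel_measurable lborel"
    "tensor \<alpha> (cutoff n) (deriv (\<lambda>x. cutoff n x * \<psi> x)) \<in> borel_measurable lborel" for n
    using borel_measurable_tensor[OF m m m] sm by auto
  have "(\<lambda>n. \<integral>z. p1 z * tensor (deriv \<alpha>) (cutoff n) (\<lambda>x. cutoff n x * \<psi> x) z \<partial>lborel)
    \<longlonglongrightarrow> (\<integral>z. p1 z * (deriv \<alpha> (fst z) * 1 * (1 * \<psi> (snd (snd z)))) \<partial>lborel)"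
    by (rule integral_mult_bounded_tendsto[OF p(1) me(1) bd1])
      (unfold tensor_def, intro tendsto_intros cutoff_tendsto)
  moreover have "(\<lambda>n. \<integral>z. p2 z * tensor \<alpha> (deriv (cutoff n)) (\<lambda>x. cutoff n x * \<psi> x) z \<partial>lborel)
    \<longlonglongrightarrow> (\<integral>z. p2 z * (\<alpha> (fst z) * 0 * (1 * \<psi> (snd (snd z)))) \<partial>lborel)"
    by (rule integral_mult_bounded_tendsto[OF p(2) me(2) bd2])
      (unfold tensor_def, intro tendsto_intros cutoff_tendsto deriv_cutoff_tendsto)
  moreover have "(\<lambda>n. \<integral>z. p3 z * tensor \<alpha> (cutoff n) (deriv (\<lambda>x. cutoff n x * \<psi> x)) z \<partial>lborel)
    \<longlonglongrightarrow> (\<integral>z. p3 z * (\<alpha> (fst z) * 1 * (0 * \<psi> (snd (snd z)) + deriv \<psi> (snd (snd z)) * 1)) \<partial>lborel)"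
    by (rule integral_mult_bounded_tendsto[OF p(3) me(3) bd3])
      (unfold tensor_def d, intro tendsto_intros cutoff_tendsto deriv_cutoff_tendsto)
  ultimately have "(\<lambda>n. (\<integral>z. p1 z * tensor (deriv \<alpha>) (cutoff n) (\<lambda>x. cutoff n x * \<psi> x) z \<partial>lborel)
      + (\<integral>z. p2 z * tensor \<alpha> (deriv (cutoff n)) (\<lambda>x. cutoff n x * \<psi> x) z \<partial>lborel)
      + (\<integral>z. p3 z * tensor \<alpha> (cutoff n) (deriv (\<lambda>x. cutoff n x * \<psi> x)) z \<partial>lborel))
    \<longlonglongrightarrow> (\<integral>z. p1 z * (deriv \<alpha> (fst z) * 1 * (1 * \<psi> (snd (snd z)))) \<partial>lborel)
      + (\<integral>z. p2 z * (\<alpha> (fst z) * 0 * (1 * \<psi> (snd (snd z)))) \<partial>lborel)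
      + (\<integral>z. p3 z * (\<alpha> (fst z) * 1 * (0 * \<psi> (snd (snd z)) + deriv \<psi> (snd (snd z)) * 1)) \<partial>lborel)"
    by (intro tendsto_add)
  moreover have "(\<integral>z. p1 z * tensor (deriv \<alpha>) (cutoff n) (\<lambda>x. cutoff n x * \<psi> x) z
      + p2 z * tensor \<alpha> (deriv (cutoff n)) (\<lambda>x. cutoff n x * \<psi> x) z
      + p3 z * tensor \<alpha> (cutoff n) (deriv (\<lambda>x. cutoff n x * \<psi> x)) z \<partial>lborel)
    = (\<integral>z. p1 z * tensor (deriv \<alpha>) (cutoff n) (\<lambda>x. cutoff n x * \<psi> x) z \<partial>lborel)
      + (\<integral>z. p2 z * tensor \<alpha> (deriv (cutoff n)) (\<lambda>x. cutoff n x * \<psi> x) z \<partial>lborel)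
      + (\<integral>z. p3 z * tensor \<alpha> (cutoff n) (deriv (\<lambda>x. cutoff n x * \<psi> x)) z \<partial>lborel)" for n
    using integrable_mult_bounded[OF p(1) me(1)[of n] bd1] integrable_mult_bounded[OF p(2) me(2)[of n] bd2]
      integrable_mult_bounded[OF p(3) me(3)[of n] bd3]
    by (simp add: Bochner_Integration.integral_add Bochner_Integration.integrable_add)
  ultimately show ?thesis by simp
qed

end

section \<open>The conservation law and the entropy inequality on a strip\<close>

definition strip :: "real \<Rightarrow> real \<Rightarrow> (real \<times> real \<times> real) set" where
  "strip a b = {a<..<b} \<times> UNIV"

lemma strip_measurable[measurable]: "strip a b \<in> sets borel"
  unfolding strip_def by (intro borel_open open_Times) auto

lemma half_space_measurable[measurable]: "half_space \<in> sets borel"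
  unfolding half_space_def by (intro borel_open open_Times) auto

text \<open>Extension by 0 turns integrals over \<open>half_space\<close> against weights supported
  in the strip into plain Lebesgue integrals of an integrable function, and it discards the values
  at t <= 0, where nothing is known about u.\<close>

definition on_strip :: "real \<Rightarrow> real \<Rightarrow> (real \<times> real \<times> real \<Rightarrow> real) \<Rightarrow> real \<times> real \<times> real \<Rightarrow> real" where
  "on_strip a b u z = indicator (strip a b) z * u z"

text \<open>For w in both L1 and L-infinity, a function of w that is O(r) on the range of w stays in
  L1; it is applied to the two flux components.\<close>

lemma integrable_of_linear_bound:
  fixes w :: "'a \<Rightarrow> real" and G :: "real \<Rightarrow> real"
  assumes w: "integrable M w" "AE z in M. \<bar>w z\<bar> \<le> C"
    and G: "G \<in> borel_measurable borel" "\<And>r. \<bar>r\<bar> \<le> C \<Longrightarrow> \<bar>G r\<bar> \<le> K * \<bar>r\<bar>"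
  shows "integrable M (\<lambda>z. G (w z))"
proof (rule Bochner_Integration.integrable_bound)
  show "integrable M (\<lambda>z. K * \<bar>w z\<bar>)" using w by auto
  have [measurable]: "w \<in> borel_measurable M" "G \<in> borel_measurable borel" using w G by auto
  show "(\<lambda>z. G (w z)) \<in> borel_measurable M" by measurable
  show "AE z in M. norm (G (w z)) \<le> norm (K * \<bar>w z\<bar>)"
    using w(2) by eventually_elim (use G(2) in fastforce)
qed

lemma flux_linear_bounds:
  fixes r :: real
  assumes "\<bar>r\<bar> \<le> C"
  shows "\<bar>r\<^sup>2 / 2\<bar> \<le> C * \<bar>r\<bar>" "\<bar>r ^ 3 / 3\<bar> \<le> C\<^sup>2 * \<bar>r\<bar>"
proof -
  have "\<bar>r\<bar> * \<bar>r\<bar> \<le> C * \<bar>r\<bar>" by (intro mult_right_mono assms) auto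
  moreover have "0 \<le> C * \<bar>r\<bar>" using assms by simp
  ultimately show "\<bar>r\<^sup>2 / 2\<bar> \<le> C * \<bar>r\<bar>"
    by (simp add: power2_eq_square abs_mult)
  have "\<bar>r\<bar>\<^sup>2 * \<bar>r\<bar> \<le> C\<^sup>2 * \<bar>r\<bar>" by (intro mult_right_mono power_mono assms) auto
  moreover have "\<bar>r ^ 3\<bar> = \<bar>r\<bar>\<^sup>2 * \<bar>r\<bar>" by (simp add: power3_eq_cube power2_eq_square abs_mult)
  ultimately show "\<bar>r ^ 3 / 3\<bar> \<le> C\<^sup>2 * \<bar>r\<bar>" by simp
qed

lemma entropy_solution_weak:
  assumes "entropy_solution u" "test_function \<phi>"
  shows "(LINT z:half_space|lborel. u z * time_deriv \<phi> z + flux (u z) \<bullet> space_grad \<phi> z) = 0"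
  using assms unfolding entropy_solution_def by blast

lemma entropy_solution_entropy:
  assumes "entropy_solution u" "test_function \<phi>" "\<And>z. 0 \<le> \<phi> z"
  shows "(LINT z:half_space|lborel. \<bar>u z - k\<bar> * time_deriv \<phi> z
           + (sgn (u z - k) *\<^sub>R (flux (u z) - flux k)) \<bullet> space_grad \<phi> z) \<ge> 0"
  using assms unfolding entropy_solution_def by blast

text \<open>It is instantiated twice: on (0,3) for Kruzhkov solutions, whose behaviour at t = 0 is
  needed, and on (1/2,3) for the limit u, which is known to be bounded only away from t = 0. In both
  cases [1,2] lies inside the interval.\<close>

locale strip_solution = smooth_step +
  fixes u :: "real \<times> real \<times> real \<Rightarrow> real" and a b C :: real
  assumes entropy: "entropy_solution u" and a_nonneg: "0 \<le> a"
    and integrable_strip: "integrable lborel (on_strip a b u)"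
    and bounded_strip: "AE z in lborel. \<bar>on_strip a b u z\<bar> \<le> C"
begin

abbreviation "w \<equiv> on_strip a b u"

lemma w_measurable[measurable]: "w \<in> borel_measurable borel"
  using integrable_strip by auto

lemma integrable_flux:
  "integrable lborel (\<lambda>z. (w z)\<^sup>2 / 2)" "integrable lborel (\<lambda>z. (w z) ^ 3 / 3)"
  by (rule integrable_of_linear_bound[OF integrable_strip bounded_strip _ flux_linear_bounds(1)], simp, assumption)
    (rule integrable_of_linear_bound[OF integrable_strip bounded_strip _ flux_linear_bounds(2)], simp, assumption)

lemma integrable_sgn_flux:
  "integrable lborel (\<lambda>z. sgn (w z) * ((w z)\<^sup>2 / 2))" "integrable lborel (\<lambda>z. sgn (w z) * ((w z) ^ 3 / 3))"
  by (rule Bochner_Integration.integrable_bound[OF integrable_flux(1)];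
      auto simp: abs_mult abs_sgn_eq)
    (rule Bochner_Integration.integrable_bound[OF integrable_flux(2)];
      auto simp: abs_mult abs_sgn_eq)

context
  fixes \<alpha> :: "real \<Rightarrow> real" and a' b' :: real and \<psi> :: "real \<Rightarrow> real" and D :: real
  assumes \<alpha>: "smooth \<alpha>" "\<And>t. t \<notin> {a'..b'} \<Longrightarrow> \<alpha> t = 0" "a < a'" "b' < b"
    and \<psi>: "smooth \<psi>" "\<And>x. \<bar>\<psi> x\<bar> \<le> D" "\<And>x. \<bar>deriv \<psi> x\<bar> \<le> D"
begin

lemma alpha_bounded: obtains A where "\<And>x. \<bar>\<alpha> x\<bar> \<le> A" "\<And>x. \<bar>deriv \<alpha> x\<bar> \<le> A"
proof -
  obtain A1 where "A1 \<ge> 0" "\<And>x. \<bar>\<alpha> x\<bar> \<le> A1"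
    using bounded_of_support[OF smooth_imp_continuous[OF \<alpha>(1)] \<alpha>(2)] by blast
  moreover have "deriv \<alpha> x = 0" if "x \<notin> {a'..b'}" for x
    by (rule deriv_zero_outside[OF \<alpha>(2) that])
  then obtain A2 where "A2 \<ge> 0" "\<And>x. \<bar>deriv \<alpha> x\<bar> \<le> A2"
    using bounded_of_support[OF smooth_imp_continuous[OF smooth_realD(2)[OF \<alpha>(1)]]] by blast
  ultimately show ?thesis
    by (intro that[of "max A1 A2"]) (auto simp: le_max_iff_disj)
qed

lemma alpha_zero:
  assumes "z \<notin> strip a b"
  shows "\<alpha> (fst z) = 0" "deriv \<alpha> (fst z) = 0"
proof -
  have "fst z \<notin> {a'..b'}" using assms \<alpha>(3,4) by (cases z) (auto simp: strip_def)
  then show "\<alpha> (fst z) = 0" "deriv \<alpha> (fst z) = 0"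
    using \<alpha>(2) deriv_zero_outside[OF \<alpha>(2)] by auto
qed

lemma test_function_cutoff:
  "test_function (tensor \<alpha> (cutoff n) (\<lambda>x. cutoff n x * \<psi> x))"
  by (rule test_function_tensor[OF \<alpha>(1) smooth_cutoff smooth_mult[OF smooth_cutoff \<psi>(1)] \<alpha>(2) _
        cutoff_support])
    (use \<alpha>(3) a_nonneg cutoff_support in auto)

lemma strip_half_space: "z \<in> strip a b \<Longrightarrow> z \<in> half_space"
  using a_nonneg by (auto simp: strip_def half_space_def)

lemma integrable_weight:
  "integrable lborel (\<lambda>z. f z * (deriv \<alpha> (fst z) * \<psi> (snd (snd z))))"
  "integrable lborel (\<lambda>z. f z * (\<alpha> (fst z) * deriv \<psi> (snd (snd z))))"
  if f: "integrable lborel f" for f :: "real \<times> real \<times> real \<Rightarrow> real"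
proof -
  obtain A where A: "\<And>x. \<bar>\<alpha> x\<bar> \<le> A" "\<And>x. \<bar>deriv \<alpha> x\<bar> \<le> A" using alpha_bounded by blast
  have m: "f \<in> borel_measurable borel" if "smooth f" for f :: "real \<Rightarrow> real"
    using smooth_imp_continuous[OF that] by (rule borel_measurable_continuous_onI)
  note m\<alpha> = m[OF \<alpha>(1)] m[OF smooth_realD(2)[OF \<alpha>(1)]]
    and m\<psi> = m[OF \<psi>(1)] m[OF smooth_realD(2)[OF \<psi>(1)]]
  have one: "\<bar>1::real\<bar> \<le> 1" for x :: real by simp
  have "integrable lborel (\<lambda>z. f z * tensor (deriv \<alpha>) (\<lambda>_. 1) \<psi> z)"
    by (rule integrable_mult_bounded[OF f _ tensor_bound[OF A(2) one \<psi>(2)]])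
      (use borel_measurable_tensor[OF m\<alpha>(2) borel_measurable_const m\<psi>(1), of 1] in simp)
  moreover have "integrable lborel (\<lambda>z. f z * tensor \<alpha> (\<lambda>_. 1) (deriv \<psi>) z)"
    by (rule integrable_mult_bounded[OF f _ tensor_bound[OF A(1) one \<psi>(3)]])
      (use borel_measurable_tensor[OF m\<alpha>(1) borel_measurable_const m\<psi>(2), of 1] in simp)
  ultimately show "integrable lborel (\<lambda>z. f z * (deriv \<alpha> (fst z) * \<psi> (snd (snd z))))"
    "integrable lborel (\<lambda>z. f z * (\<alpha> (fst z) * deriv \<psi> (snd (snd z))))"
    by (simp_all add: tensor_def)
qed

text \<open>The equation is tested with \<open>\<alpha>(t) \<chi>(x1) \<chi>(x2) \<psi>(x2)\<close>,
  where \<open>\<chi>\<close> is \<open>cutoff n\<close>. The result is 0 for every n, hence so is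
  the limit, from which the x1-flux has disappeared.\<close>

lemma conservation_law:
  "(\<integral>z. w z * (deriv \<alpha> (fst z) * \<psi> (snd (snd z))) \<partial>lborel)
     + (\<integral>z. w z ^ 3 / 3 * (\<alpha> (fst z) * deriv \<psi> (snd (snd z))) \<partial>lborel) = 0"
proof -
  obtain A where A: "\<And>x. \<bar>\<alpha> x\<bar> \<le> A" "\<And>x. \<bar>deriv \<alpha> x\<bar> \<le> A" using alpha_bounded by blast
  note L = cutoff_limit[OF integrable_strip integrable_flux \<alpha>(1) A \<psi>]
  have "(\<integral>z. w z * tensor (deriv \<alpha>) (cutoff n) (\<lambda>x. cutoff n x * \<psi> x) z
      + (w z)\<^sup>2 / 2 * tensor \<alpha> (deriv (cutoff n)) (\<lambda>x. cutoff n x * \<psi> x) z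
      + w z ^ 3 / 3 * tensor \<alpha> (cutoff n) (deriv (\<lambda>x. cutoff n x * \<psi> x)) z \<partial>lborel) = 0" for n
  proof -
    note sm = \<alpha>(1) smooth_cutoff[of n] smooth_mult[OF smooth_cutoff[of n] \<psi>(1)]
    let ?\<phi> = "tensor \<alpha> (cutoff n) (\<lambda>x. cutoff n x * \<psi> x)"
    have "(LINT z:half_space|lborel. u z * time_deriv ?\<phi> z + flux (u z) \<bullet> space_grad ?\<phi> z) = 0"
      by (rule entropy_solution_weak[OF entropy test_function_cutoff])
    also have "(LINT z:half_space|lborel. u z * time_deriv ?\<phi> z + flux (u z) \<bullet> space_grad ?\<phi> z)
      = (\<integral>z. w z * tensor (deriv \<alpha>) (cutoff n) (\<lambda>x. cutoff n x * \<psi> x) z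
      + (w z)\<^sup>2 / 2 * tensor \<alpha> (deriv (cutoff n)) (\<lambda>x. cutoff n x * \<psi> x) z
      + w z ^ 3 / 3 * tensor \<alpha> (cutoff n) (deriv (\<lambda>x. cutoff n x * \<psi> x)) z \<partial>lborel)"
      unfolding set_lebesgue_integral_def
    proof (rule Bochner_Integration.integral_cong[OF refl])
      fix z
      show "indicator half_space z *\<^sub>R (u z * time_deriv ?\<phi> z + flux (u z) \<bullet> space_grad ?\<phi> z)
        = w z * tensor (deriv \<alpha>) (cutoff n) (\<lambda>x. cutoff n x * \<psi> x) z
      + (w z)\<^sup>2 / 2 * tensor \<alpha> (deriv (cutoff n)) (\<lambda>x. cutoff n x * \<psi> x) z
      + w z ^ 3 / 3 * tensor \<alpha> (cutoff n) (deriv (\<lambda>x. cutoff n x * \<psi> x)) z"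
        \<comment> \<open>Off the strip both sides vanish, since the time weight and its derivative
          do; on it, \<open>on_strip a b u\<close> is u.\<close>
        unfolding time_deriv_tensor[OF sm] space_grad_tensor[OF sm] flux_def
        using strip_half_space[of z] alpha_zero[of z]
        by (cases "z \<in> strip a b") (simp_all add: on_strip_def tensor_def inner_prod_def)
    qed
    finally show ?thesis by simp
  qed
  with L show ?thesis by (simp add: LIMSEQ_const_iff)
qed

end

text \<open>A weak form of the monotonicity in t of the L1 norm. The level k = 0 is the one for
  which |u - k| and the entropy fluxes are integrable, so that the cut-offs can be removed.\<close>

lemma entropy_decay:
  fixes \<alpha> :: "real \<Rightarrow> real"
  assumes \<alpha>: "smooth \<alpha>" "\<And>t. t \<notin> {a'..b'} \<Longrightarrow> \<alpha> t = 0" "a < a'" "b' < b" "\<And>t. 0 \<le> \<alpha> t"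
  shows "(\<integral>z. \<bar>w z\<bar> * deriv \<alpha> (fst z) \<partial>lborel) \<ge> 0"
proof -
  have \<psi>: "smooth (\<lambda>_::real. 1)" "\<And>x::real. \<bar>1::real\<bar> \<le> 1" "\<And>x::real. \<bar>deriv (\<lambda>_. 1::real) x\<bar> \<le> 1"
    by (simp_all add: smooth_const)
  obtain A where A: "\<And>x. \<bar>\<alpha> x\<bar> \<le> A" "\<And>x. \<bar>deriv \<alpha> x\<bar> \<le> A"
    using alpha_bounded[OF \<alpha>(1-4) \<psi>] by blast
  note L = cutoff_limit[OF integrable_abs[OF integrable_strip] integrable_sgn_flux \<alpha>(1) A \<psi>]
  have "(\<integral>z. \<bar>w z\<bar> * tensor (deriv \<alpha>) (cutoff n) (\<lambda>x. cutoff n x * 1) z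
      + sgn (w z) * ((w z)\<^sup>2 / 2) * tensor \<alpha> (deriv (cutoff n)) (\<lambda>x. cutoff n x * 1) z
      + sgn (w z) * (w z ^ 3 / 3) * tensor \<alpha> (cutoff n) (deriv (\<lambda>x. cutoff n x * 1)) z \<partial>lborel) \<ge> 0" for n
  proof -
    note sm = \<alpha>(1) smooth_cutoff[of n] smooth_mult[OF smooth_cutoff[of n] \<psi>(1)]
    let ?\<phi> = "tensor \<alpha> (cutoff n) (\<lambda>x. cutoff n x * 1)"
    have "(LINT z:half_space|lborel. \<bar>u z - 0\<bar> * time_deriv ?\<phi> z
        + (sgn (u z - 0) *\<^sub>R (flux (u z) - flux 0)) \<bullet> space_grad ?\<phi> z) \<ge> 0"
      by (rule entropy_solution_entropy[OF entropy test_function_cutoff[OF \<alpha>(1-4) \<psi>]])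
        (auto simp: tensor_def intro!: mult_nonneg_nonneg \<alpha>(5) cutoff_nonneg)
    also have "(LINT z:half_space|lborel. \<bar>u z - 0\<bar> * time_deriv ?\<phi> z
        + (sgn (u z - 0) *\<^sub>R (flux (u z) - flux 0)) \<bullet> space_grad ?\<phi> z)
      = (\<integral>z. \<bar>w z\<bar> * tensor (deriv \<alpha>) (cutoff n) (\<lambda>x. cutoff n x * 1) z
      + sgn (w z) * ((w z)\<^sup>2 / 2) * tensor \<alpha> (deriv (cutoff n)) (\<lambda>x. cutoff n x * 1) z
      + sgn (w z) * (w z ^ 3 / 3) * tensor \<alpha> (cutoff n) (deriv (\<lambda>x. cutoff n x * 1)) z \<partial>lborel)"
      unfolding set_lebesgue_integral_def
    proof (rule Bochner_Integration.integral_cong[OF refl])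
      fix z
      show "indicator half_space z *\<^sub>R (\<bar>u z - 0\<bar> * time_deriv ?\<phi> z
          + (sgn (u z - 0) *\<^sub>R (flux (u z) - flux 0)) \<bullet> space_grad ?\<phi> z)
        = \<bar>w z\<bar> * tensor (deriv \<alpha>) (cutoff n) (\<lambda>x. cutoff n x * 1) z
      + sgn (w z) * ((w z)\<^sup>2 / 2) * tensor \<alpha> (deriv (cutoff n)) (\<lambda>x. cutoff n x * 1) z
      + sgn (w z) * (w z ^ 3 / 3) * tensor \<alpha> (cutoff n) (deriv (\<lambda>x. cutoff n x * 1)) z"
        unfolding time_deriv_tensor[OF sm] space_grad_tensor[OF sm] flux_def
        using strip_half_space[OF \<alpha>(1-4) \<psi>, of z] alpha_zero[OF \<alpha>(1-4) \<psi>, of z]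
        by (cases "z \<in> strip a b") (simp_all add: on_strip_def tensor_def inner_prod_def algebra_simps)
    qed
    finally show ?thesis .
  qed
  then have "0 \<le> (\<integral>z. \<bar>w z\<bar> * (deriv \<alpha> (fst z) * 1) \<partial>lborel)
      + (\<integral>z. sgn (w z) * (w z ^ 3 / 3) * (\<alpha> (fst z) * deriv (\<lambda>_. 1) (snd (snd z))) \<partial>lborel)"
    by (intro LIMSEQ_le_const[OF L]) auto
  then show ?thesis by simp
qed

text \<open>The entropy inequality at k = 0 minus the conservation law with weight 1. The quantity
  |w| - w is twice the negative part.\<close>

lemma negative_part_decay:
  fixes \<alpha> :: "real \<Rightarrow> real"
  assumes \<alpha>: "smooth \<alpha>" "\<And>t. t \<notin> {a'..b'} \<Longrightarrow> \<alpha> t = 0" "a < a'" "b' < b" "\<And>t. 0 \<le> \<alpha> t"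
  shows "(\<integral>z. (\<bar>w z\<bar> - w z) * deriv \<alpha> (fst z) \<partial>lborel) \<ge> 0"
proof -
  have \<psi>: "smooth (\<lambda>_::real. 1)" "\<And>x::real. \<bar>1::real\<bar> \<le> 1" "\<And>x::real. \<bar>deriv (\<lambda>_. 1::real) x\<bar> \<le> 1"
    by (simp_all add: smooth_const)
  have "(\<integral>z. w z * deriv \<alpha> (fst z) \<partial>lborel) = 0"
    using conservation_law[OF \<alpha>(1-4) \<psi>] by simp
  moreover have "integrable lborel (\<lambda>z. w z * deriv \<alpha> (fst z))" "integrable lborel (\<lambda>z. \<bar>w z\<bar> * deriv \<alpha> (fst z))"
    using integrable_weight(1)[OF \<alpha>(1-4) \<psi>, OF _ integrable_strip]
      integrable_weight(1)[OF \<alpha>(1-4) \<psi>, OF _ integrable_abs[OF integrable_strip]] by simp_all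
  ultimately show ?thesis
    using entropy_decay[OF \<alpha>] by (simp add: left_diff_distrib)
qed

end

section \<open>Data on the axis\<close>

lemma signed_measure_Diff:
  assumes \<nu>: "signed_measure \<nu>" and "A \<in> sets borel" "B \<in> sets borel" "B \<subseteq> A"
  shows "\<nu> A = \<nu> B + \<nu> (A - B)"
proof -
  \<comment> \<open>Finite additivity is countable additivity for the sequence B, A - B, {}, {},
    ...\<close>
  let ?A = "case_nat B (case_nat (A - B) (\<lambda>_. {}))"
  have rng: "range ?A \<subseteq> sets borel" using assms by (auto split: nat.splits)
  have disj: "disjoint_family ?A" by (auto simp: disjoint_family_on_def split: nat.splits)
  have UN: "(\<Union>i. ?A i) = A"
  proof
    show "A \<subseteq> (\<Union>i. ?A i)"
    proof
      fix x assume "x \<in> A"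
      then have "x \<in> ?A 0 \<or> x \<in> ?A (Suc 0)" by auto
      then show "x \<in> (\<Union>i. ?A i)" by blast
    qed
  qed (use assms(4) in \<open>auto split: nat.splits\<close>)
  have "\<forall>A. range A \<subseteq> sets borel \<longrightarrow> disjoint_family A \<longrightarrow>
          (\<lambda>i::nat. \<nu> (A i)) sums \<nu> (\<Union>i. A i)"
    using \<nu> unfolding signed_measure_def by blast
  from this[rule_format, OF rng disj] have sums: "(\<lambda>i. \<nu> (?A i)) sums \<nu> A"
    unfolding UN .
  have "(\<lambda>i. \<nu> (?A i)) sums (\<Sum>i\<in>{0, 1}. \<nu> (?A i))"
    using \<nu> by (intro sums_finite) (auto simp: signed_measure_def split: nat.splits)
  with sums show ?thesis
    by (simp add: sums_unique2)
qed

locale nonneg_signed_measure =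
  fixes \<nu> :: "'a::topological_space set \<Rightarrow> real"
  assumes signed: "signed_measure \<nu>" and nonneg: "nonneg_measure \<nu>"
begin

lemma nonneg_value: "A \<in> sets borel \<Longrightarrow> 0 \<le> \<nu> A"
  using nonneg by (auto simp: nonneg_measure_def)

lemma mono: "A \<in> sets borel \<Longrightarrow> B \<in> sets borel \<Longrightarrow> B \<subseteq> A \<Longrightarrow> \<nu> B \<le> \<nu> A"
  using signed_measure_Diff[OF signed, of A B] nonneg_value[of "A - B"] by auto

lemma sets_positive_variation: "sets (positive_variation \<nu>) = sets borel"
  and space_positive_variation: "space (positive_variation \<nu>) = UNIV"
  unfolding positive_variation_def
  using sets.sigma_sets_eq[of "borel :: 'a measure"] by (simp_all add: space_measure_of_conv)

text \<open>By monotonicity the supremum is attained at the set itself. That this set function is a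
  measure has to be checked all the same, because \<open>measure_of\<close> returns the zero measure
  otherwise.\<close>

lemma emeasure_positive_variation:
  assumes "A \<in> sets borel"
  shows "emeasure (positive_variation \<nu>) A = ennreal (\<nu> A)"
proof -
  have SUP: "(SUP B\<in>{B \<in> sets borel. B \<subseteq> A}. ennreal (\<nu> B)) = ennreal (\<nu> A)" if "A \<in> sets borel" for A
  proof (rule antisym)
    show "(SUP B\<in>{B \<in> sets borel. B \<subseteq> A}. ennreal (\<nu> B)) \<le> ennreal (\<nu> A)"
      by (rule SUP_least) (use that mono in \<open>auto intro: ennreal_leI\<close>)
    show "ennreal (\<nu> A) \<le> (SUP B\<in>{B \<in> sets borel. B \<subseteq> A}. ennreal (\<nu> B))"
      by (rule SUP_upper) (use that in auto)
  qed
  have "emeasure (positive_variation \<nu>) A = (SUP B\<in>{B \<in> sets borel. B \<subseteq> A}. ennreal (\<nu> B))"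
    unfolding positive_variation_def
  proof (rule emeasure_measure_of_sigma)
    show "sigma_algebra UNIV (sets (borel :: 'a measure))"
      by (metis sets.sigma_algebra_axioms space_borel)
    have "\<nu> {} = 0" using signed by (simp add: signed_measure_def)
    then show "positive (sets (borel :: 'a measure)) (\<lambda>A. SUP B\<in>{B \<in> sets borel. B \<subseteq> A}. ennreal (\<nu> B))"
      unfolding positive_def using SUP[of "{}"] by simp
    show "countably_additive (sets (borel :: 'a measure)) (\<lambda>A. SUP B\<in>{B \<in> sets borel. B \<subseteq> A}. ennreal (\<nu> B))"
      unfolding countably_additive_def
    proof (intro allI impI)
      fix A :: "nat \<Rightarrow> 'a set"
      assume A: "range A \<subseteq> sets borel" "disjoint_family A" "(\<Union>i. A i) \<in> sets borel"
      then have "(\<lambda>i. \<nu> (A i)) sums \<nu> (\<Union>i. A i)"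
        using signed unfolding signed_measure_def by blast
      then have "(\<Sum>i. ennreal (\<nu> (A i))) = ennreal (\<nu> (\<Union>i. A i))"
        using A by (intro suminf_ennreal_eq nonneg_value) auto
      moreover have "(\<lambda>i. SUP B\<in>{B \<in> sets borel. B \<subseteq> A i}. ennreal (\<nu> B)) = (\<lambda>i. ennreal (\<nu> (A i)))"
        using A(1) by (intro ext SUP) auto
      ultimately show "(\<Sum>i. SUP B\<in>{B \<in> sets borel. B \<subseteq> A i}. ennreal (\<nu> B))
        = (SUP B\<in>{B \<in> sets borel. B \<subseteq> (\<Union>i. A i)}. ennreal (\<nu> B))"
        using SUP[OF A(3)] by simp
    qed
  qed fact
  then show ?thesis using SUP[OF assms] by simp
qed

lemma negative_variation_null:
  shows "emeasure (negative_variation \<nu>) A = 0"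
proof -
  have "(SUP B\<in>{B \<in> sets borel. B \<subseteq> A}. ennreal (- \<nu> B)) = 0" for A
    by (rule antisym, rule SUP_least) (use nonneg_value in \<open>auto simp: ennreal_neg\<close>)
  then have eq: "negative_variation \<nu> = measure_of UNIV (sets borel) (\<lambda>_. 0)"
    unfolding negative_variation_def positive_variation_def by simp
  show ?thesis
    unfolding eq by (simp add: emeasure_sigma)
qed

lemma signed_integral_eq: "signed_integral \<nu> \<psi> = (LINT x|positive_variation \<nu>. \<psi> x)"
proof -
  have "AE x in negative_variation \<nu>. \<psi> x = 0"
    by (rule AE_I[of _ _ "space (negative_variation \<nu>)"]) (auto simp: negative_variation_null)
  then have "(LINT x|negative_variation \<nu>. \<psi> x) = 0"
    by (rule integral_eq_zero_AE)
  then show ?thesis by (simp add: signed_integral_def)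
qed

lemma total_variation_eq: "total_variation \<nu> = \<nu> UNIV"
  using nonneg_value[of UNIV]
  by (simp add: total_variation_def measure_def emeasure_positive_variation negative_variation_null)

lemma signed_integral_one: "signed_integral \<nu> (\<lambda>_. 1) = \<nu> UNIV"
  using nonneg_value[of UNIV]
  by (simp add: signed_integral_eq space_positive_variation measure_def emeasure_positive_variation)

end

lemma axis_measure_nonneg_signed:
  assumes "signed_measure g" "nonneg_measure g"
  shows "nonneg_signed_measure (axis_measure g)"
proof
  have pre: "{x2. (0, x2) \<in> A} \<in> sets borel" if "A \<in> sets borel" for A :: "(real \<times> real) set"
  proof -
    have "(\<lambda>y. (0::real, y::real)) \<in> borel_measurable borel"
      by (intro borel_measurable_continuous_onI continuous_intros)
    from measurable_sets[OF this that] show ?thesis by (simp add: vimage_def)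
  qed
  show "nonneg_measure (axis_measure g)"
    using assms(2) pre by (auto simp: nonneg_measure_def axis_measure_def)
  show "signed_measure (axis_measure g)"
    unfolding signed_measure_def
  proof (intro conjI allI impI)
    show "axis_measure g {} = 0" using assms(1) by (simp add: axis_measure_def signed_measure_def)
    fix A :: "nat \<Rightarrow> (real \<times> real) set"
    assume A: "range A \<subseteq> sets borel" "disjoint_family A"
    have "range (\<lambda>i. {x2. (0, x2) \<in> A i}) \<subseteq> sets borel" using A(1) pre by auto
    moreover have "disjoint_family (\<lambda>i. {x2. (0, x2) \<in> A i})"
      using A(2) unfolding disjoint_family_on_def by blast
    ultimately have "(\<lambda>i. g {x2. (0, x2) \<in> A i}) sums g (\<Union>i. {x2. (0, x2) \<in> A i})"
      using assms(1) unfolding signed_measure_def by blast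
    moreover have "(\<Union>i. {x2. (0, x2) \<in> A i}) = {x2. (0, x2) \<in> (\<Union>i. A i)}" by auto
    ultimately show "(\<lambda>i. axis_measure g (A i)) sums axis_measure g (\<Union>i. A i)"
      by (simp add: axis_measure_def)
  qed
qed

text \<open>The axis measure does not charge {x1 \<noteq> 0}. This gives the invariance of the datum
  under dilations of x1.\<close>

lemma signed_integral_axis_cong:
  assumes g: "signed_measure g" "nonneg_measure g"
    and cont: "continuous_on UNIV \<psi>" "continuous_on UNIV \<psi>'"
    and eq: "\<And>y. \<psi> (0, y) = \<psi>' (0, y)"
  shows "signed_integral (axis_measure g) \<psi> = signed_integral (axis_measure g) \<psi>'"
proof -
  interpret nonneg_signed_measure "axis_measure g" by (rule axis_measure_nonneg_signed[OF g])
  have meas: "\<psi> \<in> borel_measurable (positive_variation (axis_measure g))"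
    "\<psi>' \<in> borel_measurable (positive_variation (axis_measure g))"
    using cont sets_positive_variation measurable_cong_sets borel_measurable_continuous_onI by blast+
  have "open {x :: real \<times> real. fst x \<noteq> 0}"
    by (intro open_Collect_neq continuous_intros)
  then have S: "{x :: real \<times> real. fst x \<noteq> 0} \<in> sets borel" by (rule borel_open)
  have "AE x in positive_variation (axis_measure g). \<psi> x = \<psi>' x"
  proof (rule AE_I)
    show "{x \<in> space (positive_variation (axis_measure g)). \<not> \<psi> x = \<psi>' x} \<subseteq> {x. fst x \<noteq> 0}"
      using eq by auto
    show "{x. fst x \<noteq> 0} \<in> sets (positive_variation (axis_measure g))"
      using S by (simp add: sets_positive_variation)
    have "g {} = 0" using g(1) by (simp add: signed_measure_def)
    then show "emeasure (positive_variation (axis_measure g)) {x. fst x \<noteq> 0} = 0"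
      using emeasure_positive_variation[OF S] by (simp add: axis_measure_def)
  qed
  then show ?thesis
    unfolding signed_integral_eq by (intro integral_cong_AE meas)
qed

lemma eventually_ess_at_right:
  "eventually Q (inf (at_right (0::real)) (ae_filter lborel)) \<longleftrightarrow>
     (\<exists>\<delta>>0. AE t in lborel. 0 < t \<longrightarrow> t < \<delta> \<longrightarrow> Q t)"
proof
  assume "eventually Q (inf (at_right (0::real)) (ae_filter lborel))"
  then obtain Q1 Q2 where "eventually Q1 (at_right (0::real))" and Q2: "AE t in lborel. Q2 t"
    and Q: "\<And>t. Q1 t \<Longrightarrow> Q2 t \<Longrightarrow> Q t"
    unfolding eventually_inf by blast
  then obtain \<delta> where "\<delta> > 0" "\<And>t. 0 < t \<Longrightarrow> t < \<delta> \<Longrightarrow> Q1 t"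
    unfolding eventually_at_right_field by blast
  moreover have "AE t in lborel. 0 < t \<longrightarrow> t < \<delta> \<longrightarrow> Q t"
    using Q2 by eventually_elim (use Q calculation(2) in blast)
  ultimately show "\<exists>\<delta>>0. AE t in lborel. 0 < t \<longrightarrow> t < \<delta> \<longrightarrow> Q t" by blast
next
  assume "\<exists>\<delta>>0. AE t in lborel. 0 < t \<longrightarrow> t < \<delta> \<longrightarrow> Q t"
  then obtain \<delta> where \<delta>: "\<delta> > 0" "AE t in lborel. 0 < t \<longrightarrow> t < \<delta> \<longrightarrow> Q t" by blast
  have "eventually (\<lambda>t. 0 < t \<and> t < \<delta>) (at_right (0::real))"
    unfolding eventually_at_right_field using \<delta>(1) by blast
  then show "eventually Q (inf (at_right (0::real)) (ae_filter lborel))"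
    unfolding eventually_inf using \<delta>(2) by blast
qed

section \<open>Invariance under the scaling and constancy of the marginals\<close>

text \<open>Here s is the square root of the scaling parameter \<open>\<mu>\<close>, which keeps
  square roots out of the formulas.\<close>

definition dilate :: "real \<Rightarrow> real \<times> real \<times> real \<Rightarrow> real \<times> real \<times> real" where
  "dilate s z = (s\<^sup>2 * fst z, s * fst (snd z), snd (snd z))"

definition rescale :: "real \<Rightarrow> (real \<times> real \<times> real \<Rightarrow> real) \<Rightarrow> real \<times> real \<times> real \<Rightarrow> real" where
  "rescale s u z = s * u (dilate s z)"

lemma scaling_dilate: "s > 0 \<Longrightarrow> scaling (s\<^sup>2 * s) (dilate s)"
  unfolding dilate_def[abs_def] by (rule scaling_spacetime) auto

lemma bounded_linear_dilate: "bounded_linear (dilate s)"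
  unfolding dilate_def[abs_def]
  by (intro bounded_linear_Pair bounded_linear_const_mult bounded_linear_fst
      bounded_linear_fst_comp bounded_linear_snd_comp bounded_linear_snd)

lemma dilate_inverse: "s > 0 \<Longrightarrow> dilate s (dilate (inverse s) z) = z"
  by (cases z) (simp add: dilate_def power_inverse)

lemma dilate_half_space: "s > 0 \<Longrightarrow> dilate s z \<in> half_space \<longleftrightarrow> z \<in> half_space"
  by (cases z) (simp add: dilate_def half_space_def zero_less_mult_iff)

lemma test_function_imp_smooth: "test_function \<phi> \<Longrightarrow> smooth \<phi>"
  by (simp add: test_function_def smooth_def)

lemma test_function_dilate:
  assumes "s > 0" and \<phi>: "test_function \<phi>"
  shows "test_function (\<lambda>z. \<phi> (dilate s z))"
proof -
  define K where "K = closure {z. \<phi> z \<noteq> 0}"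
  have K: "compact K" "K \<subseteq> half_space" using \<phi> by (auto simp: test_function_def K_def)
  define K' where "K' = dilate (inverse s) ` K"
  have "compact K'"
    unfolding K'_def
    by (intro compact_continuous_image K linear_continuous_on bounded_linear_dilate)
  have "K' \<subseteq> half_space"
    using K(2) assms(1) dilate_half_space[of "inverse s"] by (auto simp: K'_def)
  have "{z. \<phi> (dilate s z) \<noteq> 0} \<subseteq> K'"
  proof
    fix z assume "z \<in> {z. \<phi> (dilate s z) \<noteq> 0}"
    then have "dilate s z \<in> K" using closure_subset[of "{z. \<phi> z \<noteq> 0}"] by (auto simp: K_def)
    moreover have "z = dilate (inverse s) (dilate s z)"
      using dilate_inverse[of "inverse s" z] assms(1) by simp
    ultimately show "z \<in> K'" unfolding K'_def by blast
  qed
  then have "closure {z. \<phi> (dilate s z) \<noteq> 0} \<subseteq> K'"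
    by (rule closure_minimal) (rule compact_imp_closed[OF \<open>compact K'\<close>])
  moreover from this have "compact (closure {z. \<phi> (dilate s z) \<noteq> 0})"
    using \<open>compact K'\<close> closed_closure by (metis compact_Int_closed inf.absorb_iff2)
  moreover have "smooth (\<lambda>z. \<phi> (dilate s z))"
    using smooth_compose_affine[OF bounded_linear_dilate test_function_imp_smooth[OF \<phi>], of s 0] by simp
  ultimately show ?thesis
    using \<open>K' \<subseteq> half_space\<close> by (auto simp: test_function_def smooth_def)
qed

lemma frechet_derivative_dilate:
  assumes "smooth \<phi>"
  shows "frechet_derivative (\<lambda>z. \<phi> (dilate s z)) (at z) = (\<lambda>h. frechet_derivative \<phi> (at (dilate s z)) (dilate s h))"
proof -
  have "((\<lambda>z. \<phi> (dilate s z)) has_derivative (\<lambda>h. frechet_derivative \<phi> (at (dilate s z)) (dilate s h))) (at z)"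
    using diff_chain_at[OF bounded_linear_imp_has_derivative[OF bounded_linear_dilate]
        smooth_has_derivative[OF assms]]
    by (simp add: o_def)
  from frechet_derivative_at[OF this] show ?thesis by simp
qed

lemma derivatives_dilate:
  assumes "smooth \<phi>"
  shows "time_deriv (\<lambda>z. \<phi> (dilate s z)) z = s\<^sup>2 * time_deriv \<phi> (dilate s z)"
    and "space_grad (\<lambda>z. \<phi> (dilate s z)) z
      = (s * fst (space_grad \<phi> (dilate s z)), snd (space_grad \<phi> (dilate s z)))"
proof -
  have lin: "frechet_derivative \<phi> (at x) (c *\<^sub>R h) = c * frechet_derivative \<phi> (at x) h" for x c h
    using linear_cmul[OF has_derivative_linear[OF smooth_has_derivative[OF assms]]] by simp
  have d: "dilate s (1, 0, 0) = s\<^sup>2 *\<^sub>R (1, 0, 0)" "dilate s (0, 1, 0) = s *\<^sub>R (0, 1, 0)"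
    "dilate s (0, 0, 1) = (0, 0, 1)"
    by (simp_all add: dilate_def)
  show "time_deriv (\<lambda>z. \<phi> (dilate s z)) z = s\<^sup>2 * time_deriv \<phi> (dilate s z)"
    by (simp only: time_deriv_def frechet_derivative_dilate[OF assms] d lin)
  show "space_grad (\<lambda>z. \<phi> (dilate s z)) z
      = (s * fst (space_grad \<phi> (dilate s z)), snd (space_grad \<phi> (dilate s z)))"
    by (simp only: space_grad_def frechet_derivative_dilate[OF assms] d lin fst_conv snd_conv)
qed

lemma flux_inner:
  "flux r \<bullet> p = r\<^sup>2 / 2 * fst p + r ^ 3 / 3 * snd p"
  "(c *\<^sub>R (flux r - flux k)) \<bullet> p
    = c * ((r\<^sup>2 / 2 - k\<^sup>2 / 2) * fst p + (r ^ 3 / 3 - k ^ 3 / 3) * snd p)"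
  by (simp_all add: flux_def inner_prod_def distrib_left)

text \<open>The scaling is tuned so that every term gains the same factor s^3: s * s^2 from u and
  the time derivative, s^2 * s from u^2 and the x1 derivative, s^3 * 1 from u^3 and the x2
  derivative.\<close>

lemma rescale_algebra:
  fixes s r :: real
  shows "s * r * (s\<^sup>2 * p) + ((s * r)\<^sup>2 / 2 * (s * q1) + (s * r) ^ 3 / 3 * q2)
    = s ^ 3 * (r * p + (r\<^sup>2 / 2 * q1 + r ^ 3 / 3 * q2))"
  by (simp add: power2_eq_square power3_eq_cube algebra_simps)

lemma rescale_entropy_algebra:
  fixes s r :: real
  shows "s * A * (s\<^sup>2 * p) + c * (((s * r)\<^sup>2 / 2 - (s * l)\<^sup>2 / 2) * (s * q1)
      + ((s * r) ^ 3 / 3 - (s * l) ^ 3 / 3) * q2)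
    = s ^ 3 * (A * p + c * ((r\<^sup>2 / 2 - l\<^sup>2 / 2) * q1 + (r ^ 3 / 3 - l ^ 3 / 3) * q2))"
  by (simp add: power2_eq_square power3_eq_cube algebra_simps)

lemma borel_measurable_derivatives:
  assumes "smooth \<phi>"
  shows "time_deriv \<phi> \<in> borel_measurable borel" "(\<lambda>z. fst (space_grad \<phi> z)) \<in> borel_measurable borel"
    "(\<lambda>z. snd (space_grad \<phi> z)) \<in> borel_measurable borel"
  unfolding time_deriv_def[abs_def] space_grad_def[abs_def] fst_conv snd_conv
  by (intro borel_measurable_continuous_onI smooth_imp_continuous smooth_frechet_derivative assms)+

text \<open>Every test function is the pull-back of another one under \<open>dilate s\<close>. The
  change of variables then turns each integral for the rescaled function into a positive multiple of
  the corresponding integral for u.\<close>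

lemma entropy_solution_rescale:
  assumes s: "s > 0" and u: "entropy_solution u"
  shows "entropy_solution (rescale s u)"
proof -
  note T = scaling_dilate[OF s]
  have Tm[measurable]: "dilate s \<in> borel_measurable borel" using T by (simp add: scaling_def)
  \<comment> \<open>The function u is only measurable on \<open>half_space\<close>, whereas the
    change of variables needs a Borel function on the whole space.\<close>
  define w where "w z = indicator half_space z * u z" for z
  have w[measurable]: "w \<in> borel_measurable borel"
    using u by (simp add: entropy_solution_def set_borel_measurable_def w_def[abs_def])
  have ind: "indicator half_space (dilate s z) = (indicator half_space z :: real)" for z
    using dilate_half_space[OF s, of z] by (simp add: indicator_def)
  have test: "\<exists>\<phi>'. test_function \<phi>' \<and> \<phi> = (\<lambda>z. \<phi>' (dilate s z)) \<and> ((\<forall>z. 0 \<le> \<phi> z) \<longrightarrow> (\<forall>z. 0 \<le> \<phi>' z))"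
    if "test_function \<phi>" for \<phi>
    using test_function_dilate[of "inverse s", OF _ that] s dilate_inverse[of "inverse s"]
    by (intro exI[of _ "\<lambda>z. \<phi> (dilate (inverse s) z)"]) (auto simp del: split_paired_All)
  show ?thesis
    unfolding entropy_solution_def
  proof (intro conjI allI impI)
    have "(\<lambda>z. s * w (dilate s z)) \<in> borel_measurable borel" by measurable
    then show "set_borel_measurable lborel half_space (rescale s u)"
      by (simp add: set_borel_measurable_def w_def ind rescale_def mult_ac)
  next
    fix \<tau> :: real assume "\<tau> > 0"
    then have "s\<^sup>2 * \<tau> > 0" using s by simp
    then obtain C where "AE z in lborel. s\<^sup>2 * \<tau> < fst z \<longrightarrow> \<bar>u z\<bar> \<le> C"
      using u unfolding entropy_solution_def by blast
    from scaling_AE[OF T this] have "AE z in lborel. \<tau> < fst z \<longrightarrow> \<bar>rescale s u z\<bar> \<le> s * C"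
      by eventually_elim (use s in \<open>simp add: rescale_def dilate_def abs_mult\<close>)
    then show "\<exists>C. AE z in lborel. \<tau> < fst z \<longrightarrow> \<bar>rescale s u z\<bar> \<le> C" by blast
  next
    fix \<phi> :: "real \<times> real \<times> real \<Rightarrow> real" assume "test_function \<phi>"
    with test obtain \<phi>' where \<phi>': "test_function \<phi>'" "\<phi> = (\<lambda>z. \<phi>' (dilate s z))" by blast
    note sm = test_function_imp_smooth[OF \<phi>'(1)]
    note [measurable] = borel_measurable_derivatives[OF sm]
    define G where "G z = indicator half_space z * (w z * time_deriv \<phi>' z
      + ((w z)\<^sup>2 / 2 * fst (space_grad \<phi>' z) + w z ^ 3 / 3 * snd (space_grad \<phi>' z)))" for z
    have [measurable]: "G \<in> borel_measurable borel" unfolding G_def[abs_def] by measurable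
    have Gd: "G (dilate s z) = indicator half_space z * (u (dilate s z) * time_deriv \<phi>' (dilate s z)
        + ((u (dilate s z))\<^sup>2 / 2 * fst (space_grad \<phi>' (dilate s z))
          + u (dilate s z) ^ 3 / 3 * snd (space_grad \<phi>' (dilate s z))))" for z
      using ind[of z] by (simp add: G_def w_def indicator_def)
    have "(\<integral>z. G z \<partial>lborel) = (LINT z:half_space|lborel. u z * time_deriv \<phi>' z + flux (u z) \<bullet> space_grad \<phi>' z)"
      unfolding set_lebesgue_integral_def
      by (intro Bochner_Integration.integral_cong refl)
        (simp add: G_def w_def flux_inner indicator_def)
    also have "\<dots> = 0" by (rule entropy_solution_weak[OF u \<phi>'(1)])
    finally have "(\<integral>z. G (dilate s z) \<partial>lborel) = 0"
      using scaling_integral(1)[OF T, of G] s by simp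
    moreover have "(LINT z:half_space|lborel. rescale s u z * time_deriv \<phi> z + flux (rescale s u z) \<bullet> space_grad \<phi> z)
      = (\<integral>z. s ^ 3 * G (dilate s z) \<partial>lborel)"
      unfolding set_lebesgue_integral_def \<phi>'(2) derivatives_dilate[OF sm]
      by (intro Bochner_Integration.integral_cong refl)
        (simp only: Gd flux_inner(1) rescale_def fst_conv snd_conv rescale_algebra real_scaleR_def,
          rule mult.left_commute)
    ultimately show "(LINT z:half_space|lborel. rescale s u z * time_deriv \<phi> z + flux (rescale s u z) \<bullet> space_grad \<phi> z) = 0"
      by simp
  next
    fix k and \<phi> :: "real \<times> real \<times> real \<Rightarrow> real" assume "test_function \<phi>" "\<forall>z. 0 \<le> \<phi> z"
    with test obtain \<phi>' where \<phi>': "test_function \<phi>'" "\<phi> = (\<lambda>z. \<phi>' (dilate s z))" "\<And>z. 0 \<le> \<phi>' z" by metis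
    note sm = test_function_imp_smooth[OF \<phi>'(1)]
    note [measurable] = borel_measurable_derivatives[OF sm]
    \<comment> \<open>The Kruzhkov level scales like the solution: level k for the rescaled function
      corresponds to level k / s for u.\<close>
    define l where "l = k / s"
    have k: "k = s * l" using s by (simp add: l_def)
    define G where "G z = indicator half_space z * (\<bar>w z - l\<bar> * time_deriv \<phi>' z
      + sgn (w z - l) * (((w z)\<^sup>2 / 2 - l\<^sup>2 / 2) * fst (space_grad \<phi>' z)
        + (w z ^ 3 / 3 - l ^ 3 / 3) * snd (space_grad \<phi>' z)))" for z
    have [measurable]: "G \<in> borel_measurable borel" unfolding G_def[abs_def] by measurable
    have "(\<integral>z. G z \<partial>lborel) = (LINT z:half_space|lborel. \<bar>u z - l\<bar> * time_deriv \<phi>' z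
           + (sgn (u z - l) *\<^sub>R (flux (u z) - flux l)) \<bullet> space_grad \<phi>' z)"
      unfolding set_lebesgue_integral_def
      by (intro Bochner_Integration.integral_cong refl)
        (simp add: G_def w_def flux_inner(2) indicator_def del: inner_scaleR_left)
    also have "\<dots> \<ge> 0" by (rule entropy_solution_entropy[OF u \<phi>'(1,3)])
    finally have "0 \<le> (s\<^sup>2 * s) * (\<integral>z. G (dilate s z) \<partial>lborel)"
      using scaling_integral(1)[OF T, of G] by simp
    moreover have "0 < s\<^sup>2 * s" using s by simp
    ultimately have nn: "(\<integral>z. G (dilate s z) \<partial>lborel) \<ge> 0"
      by (metis not_less zero_le_mult_iff)
    have abs: "\<bar>s * x - s * l\<bar> = s * \<bar>x - l\<bar>" and sgn: "sgn (s * x - s * l) = sgn (x - l)" for x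
      using s by (simp_all add: abs_mult sgn_mult flip: right_diff_distrib)
    have Gd: "G (dilate s z) = indicator half_space z * (\<bar>u (dilate s z) - l\<bar> * time_deriv \<phi>' (dilate s z)
        + sgn (u (dilate s z) - l) * (((u (dilate s z))\<^sup>2 / 2 - l\<^sup>2 / 2) * fst (space_grad \<phi>' (dilate s z))
          + (u (dilate s z) ^ 3 / 3 - l ^ 3 / 3) * snd (space_grad \<phi>' (dilate s z))))" for z
      using ind[of z] by (simp add: G_def w_def indicator_def)
    have "(LINT z:half_space|lborel. \<bar>rescale s u z - k\<bar> * time_deriv \<phi> z
           + (sgn (rescale s u z - k) *\<^sub>R (flux (rescale s u z) - flux k)) \<bullet> space_grad \<phi> z)
      = (\<integral>z. s ^ 3 * G (dilate s z) \<partial>lborel)"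
      unfolding set_lebesgue_integral_def \<phi>'(2) derivatives_dilate[OF sm] rescale_def k abs sgn
      by (intro Bochner_Integration.integral_cong refl)
        (simp only: Gd flux_inner(2) fst_conv snd_conv rescale_entropy_algebra real_scaleR_def,
          rule mult.left_commute)
    then show "(LINT z:half_space|lborel. \<bar>rescale s u z - k\<bar> * time_deriv \<phi> z
           + (sgn (rescale s u z - k) *\<^sub>R (flux (rescale s u z) - flux k)) \<bullet> space_grad \<phi> z) \<ge> 0"
      using nn s by simp
  qed
qed

lemma rescale_slice: "rescale s u (t, x) = s * u (s\<^sup>2 * t, s * fst x, snd x)"
  by (simp add: rescale_def dilate_def)

text \<open>In each time slice the factor s is exactly compensated by the Jacobian of the dilation
  of x1. This preserves the L1 bound and moves the dilation to the test function.\<close>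

lemma admissible_solution_rescale:
  assumes s: "s > 0" and g: "signed_measure g" "nonneg_measure g"
    and u: "admissible_solution (axis_measure g) u"
  shows "admissible_solution (axis_measure g) (rescale s u)"
proof -
  note R = scaling_plane[OF s]
  have Rm[measurable]: "(\<lambda>x::real \<times> real. (s * fst x, snd x)) \<in> borel_measurable borel"
    using R by (simp add: scaling_def)
  have s2: "s\<^sup>2 > 0" using s by simp
  obtain C where C: "AE t in lborel. 0 < t \<longrightarrow>
        integrable lborel (\<lambda>x. u (t, x)) \<and> (LINT x|lborel. \<bar>u (t, x)\<bar>) \<le> C"
    using u unfolding admissible_solution_def by blast
  from scaling_AE[OF scaling_real[OF s2] C]
  have C': "AE t in lborel. 0 < t \<longrightarrow>
        integrable lborel (\<lambda>x. u (s\<^sup>2 * t, x)) \<and> (LINT x|lborel. \<bar>u (s\<^sup>2 * t, x)\<bar>) \<le> C"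
    by eventually_elim (use s2 in \<open>simp add: zero_less_mult_iff\<close>)
  show ?thesis
    unfolding admissible_solution_def
  proof (intro conjI allI impI)
    show "entropy_solution (rescale s u)"
      using entropy_solution_rescale[OF s] u by (simp add: admissible_solution_def)
    have "AE t in lborel. 0 < t \<longrightarrow>
        integrable lborel (\<lambda>x. rescale s u (t, x)) \<and> (LINT x|lborel. \<bar>rescale s u (t, x)\<bar>) \<le> C"
      using C'
    proof eventually_elim
      case (elim t)
      show ?case
      proof
        assume "0 < t"
        with elim have i: "integrable lborel (\<lambda>x. u (s\<^sup>2 * t, x))"
          and le: "(LINT x|lborel. \<bar>u (s\<^sup>2 * t, x)\<bar>) \<le> C" by auto
        have [measurable]: "(\<lambda>x. u (s\<^sup>2 * t, x)) \<in> borel_measurable borel" using i by auto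
        have "(LINT x|lborel. \<bar>u (s\<^sup>2 * t, x)\<bar>) = (LINT x|lborel. \<bar>rescale s u (t, x)\<bar>)"
          using scaling_integral(1)[OF R, of "\<lambda>x. \<bar>u (s\<^sup>2 * t, x)\<bar>"] s
          by (simp add: rescale_slice abs_mult)
        moreover have "integrable lborel (\<lambda>x. rescale s u (t, x))"
          using scaling_integral(2)[OF R, of "\<lambda>x. u (s\<^sup>2 * t, x)"] i by (simp add: rescale_slice)
        ultimately show "integrable lborel (\<lambda>x. rescale s u (t, x)) \<and> (LINT x|lborel. \<bar>rescale s u (t, x)\<bar>) \<le> C"
          using le by simp
      qed
    qed
    then show "\<exists>C. AE t in lborel. 0 < t \<longrightarrow>
        integrable lborel (\<lambda>x. rescale s u (t, x)) \<and> (LINT x|lborel. \<bar>rescale s u (t, x)\<bar>) \<le> C" by blast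
  next
    fix \<psi> :: "real \<times> real \<Rightarrow> real" assume \<psi>: "continuous_on UNIV \<psi>" "bounded (range \<psi>)"
    \<comment> \<open>Undoing the dilation inside the test function does not change it on the axis,
      so the narrow limit is the same.\<close>
    define \<psi>' where "\<psi>' x = \<psi> (inverse s * fst x, snd x)" for x
    have \<psi>'_cont: "continuous_on UNIV \<psi>'"
      unfolding \<psi>'_def by (intro continuous_on_compose2[OF \<psi>(1)] continuous_intros) auto
    have [measurable]: "\<psi>' \<in> borel_measurable borel"
      using \<psi>'_cont by (rule borel_measurable_continuous_onI)
    have "bounded (range \<psi>')"
      by (rule bounded_subset[OF \<psi>(2)]) (auto simp: \<psi>'_def)
    with u \<psi>'_cont have lim: "((\<lambda>t. LINT x|lborel. u (t, x) * \<psi>' x) \<longlongrightarrow> signed_integral (axis_measure g) \<psi>')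
          (inf (at_right 0) (ae_filter lborel))"
      unfolding admissible_solution_def by blast
    have eq: "signed_integral (axis_measure g) \<psi>' = signed_integral (axis_measure g) \<psi>"
      by (rule signed_integral_axis_cong[OF g \<psi>'_cont \<psi>(1)]) (simp add: \<psi>'_def)
    show "((\<lambda>t. LINT x|lborel. rescale s u (t, x) * \<psi> x) \<longlongrightarrow> signed_integral (axis_measure g) \<psi>)
          (inf (at_right 0) (ae_filter lborel))"
      unfolding tendsto_iff
    proof (intro allI impI)
      fix e :: real assume "e > 0"
      with lim have "eventually (\<lambda>t. dist (LINT x|lborel. u (t, x) * \<psi>' x)
          (signed_integral (axis_measure g) \<psi>) < e) (inf (at_right 0) (ae_filter lborel))"
        unfolding eq by (rule tendstoD)
      then obtain \<delta> where \<delta>: "\<delta> > 0" "AE t in lborel. 0 < t \<longrightarrow> t < \<delta> \<longrightarrow>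
          dist (LINT x|lborel. u (t, x) * \<psi>' x) (signed_integral (axis_measure g) \<psi>) < e"
        unfolding eventually_ess_at_right by blast
      \<comment> \<open>The time of the rescaled slice is s^2 t, so the neighbourhood (0,
        \<open>\<delta>\<close>) shrinks or grows to (0, \<open>\<delta>\<close> / s^2).\<close>
      have "AE t in lborel. 0 < t \<longrightarrow> t < \<delta> / s\<^sup>2 \<longrightarrow>
          dist (LINT x|lborel. rescale s u (t, x) * \<psi> x) (signed_integral (axis_measure g) \<psi>) < e"
        using scaling_AE[OF scaling_real[OF s2] \<delta>(2)] C'
      proof eventually_elim
        case (elim t)
        show ?case
        proof (intro impI)
          assume t: "0 < t" "t < \<delta> / s\<^sup>2"
          then have [measurable]: "(\<lambda>x. u (s\<^sup>2 * t, x)) \<in> borel_measurable borel" using elim(2) by auto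
          have "(LINT x|lborel. u (s\<^sup>2 * t, x) * \<psi>' x) = (LINT x|lborel. rescale s u (t, x) * \<psi> x)"
          proof -
            have m: "(\<lambda>x. u (s\<^sup>2 * t, x) * \<psi>' x) \<in> borel_measurable borel" by measurable
            have c: "inverse s * (s * y) = y" for y using s by simp
            show ?thesis
              using scaling_integral(1)[OF R m] by (simp add: rescale_slice \<psi>'_def mult.assoc c)
          qed
          moreover have "0 < s\<^sup>2 * t" "s\<^sup>2 * t < \<delta>"
            using t s2 by (auto simp: field_simps)
          ultimately show "dist (LINT x|lborel. rescale s u (t, x) * \<psi> x) (signed_integral (axis_measure g) \<psi>) < e"
            using elim(1) by simp
        qed
      qed
      then show "eventually (\<lambda>t. dist (LINT x|lborel. rescale s u (t, x) * \<psi> x)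
          (signed_integral (axis_measure g) \<psi>) < e) (inf (at_right 0) (ae_filter lborel))"
        unfolding eventually_ess_at_right using \<delta>(1) s2 by (intro exI[of _ "\<delta> / s\<^sup>2"]) auto
    qed
  qed
qed

lemma AE_slices:
  fixes Q :: "real \<times> real \<times> real \<Rightarrow> bool"
  assumes "AE z in lborel. Q z"
  shows "AE t in lborel. AE x in lborel. Q (t, x)"
proof -
  have "AE z in lborel \<Otimes>\<^sub>M lborel. Q z" unfolding lborel_prod by (rule assms)
  then show ?thesis by (rule lborel_pair.AE_pair)
qed

text \<open>The identity F(t) = F(s^2 t) holds outside a null set that depends on s, so s cannot be
  sent to 0 for a fixed t. Instead one s is chosen for each n that brings the whole interval (0,n)
  into the region where F is within 1/(n+1) of its limit; only countably many null sets
  arise.\<close>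

lemma marginal_constant:
  assumes g: "signed_measure g" "nonneg_measure g"
    and u: "unique_admissible_solution (axis_measure g) u"
    and \<psi>: "continuous_on UNIV \<psi>" "bounded (range \<psi>)"
  shows "AE t in lborel. 0 < t \<longrightarrow>
    (LINT x|lborel. u (t, x) * \<psi> (snd x)) = signed_integral (axis_measure g) (\<lambda>x. \<psi> (snd x))"
proof -
  define F where "F t = (LINT x|lborel. u (t, x) * \<psi> (snd x))" for t
  define L where "L = signed_integral (axis_measure g) (\<lambda>x. \<psi> (snd x))"
  have adm: "admissible_solution (axis_measure g) u"
    using u by (simp add: unique_admissible_solution_def)
  have \<psi>_snd: "continuous_on UNIV (\<lambda>x::real \<times> real. \<psi> (snd x))" "bounded (range (\<lambda>x::real \<times> real. \<psi> (snd x)))"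
    by (auto intro!: continuous_on_compose2[OF \<psi>(1)] continuous_intros bounded_subset[OF \<psi>(2)])
  have [measurable]: "(\<lambda>x::real \<times> real. \<psi> (snd x)) \<in> borel_measurable borel"
    using \<psi>_snd(1) by (rule borel_measurable_continuous_onI)
  \<comment> \<open>Uniqueness identifies u with its rescaling. The Jacobian absorbs the factor s,
    and the weight is untouched because it depends on x2 alone.\<close>
  have inv: "AE t in lborel. 0 < t \<longrightarrow> F t = F (s\<^sup>2 * t)" if s: "s > 0" for s
  proof -
    have "AE z in lborel. z \<in> half_space \<longrightarrow> rescale s u z = u z"
      using u admissible_solution_rescale[OF s g adm] by (simp add: unique_admissible_solution_def)
    note sl = AE_slices[OF this]
    obtain C where "AE t in lborel. 0 < t \<longrightarrow>
        integrable lborel (\<lambda>x. u (t, x)) \<and> (LINT x|lborel. \<bar>u (t, x)\<bar>) \<le> C"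
      using adm unfolding admissible_solution_def by blast
    then have i: "AE t in lborel. 0 < t \<longrightarrow> integrable lborel (\<lambda>x. u (t, x))"
      by eventually_elim auto
    have s2: "s\<^sup>2 > 0" using s by simp
    show ?thesis
      using sl i scaling_AE[OF scaling_real[OF s2] i]
    proof eventually_elim
      case (elim t)
      show ?case
      proof
        assume "0 < t"
        then have [measurable]: "(\<lambda>x. u (t, x)) \<in> borel_measurable borel"
          "(\<lambda>x. u (s\<^sup>2 * t, x)) \<in> borel_measurable borel"
          using elim(2,3) s2 by auto
        have Rm[measurable]: "(\<lambda>x::real \<times> real. (s * fst x, snd x)) \<in> borel_measurable borel"
          using scaling_plane[OF s] by (simp add: scaling_def)
        have [measurable]: "(\<lambda>x. u (s\<^sup>2 * t, s * fst x, snd x)) \<in> borel_measurable borel"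
          using measurable_compose[OF Rm \<open>(\<lambda>x. u (s\<^sup>2 * t, x)) \<in> borel_measurable borel\<close>] by simp
        have "F t = (LINT x|lborel. s * u (s\<^sup>2 * t, s * fst x, snd x) * \<psi> (snd x))"
          unfolding F_def
        proof (rule integral_cong_AE)
          show "AE x in lborel. u (t, x) * \<psi> (snd x) = s * u (s\<^sup>2 * t, s * fst x, snd x) * \<psi> (snd x)"
            using elim(1) by eventually_elim (use \<open>0 < t\<close> in \<open>simp add: half_space_def rescale_slice\<close>)
        qed measurable
        also have "\<dots> = F (s\<^sup>2 * t)"
        proof -
          have m: "(\<lambda>x. u (s\<^sup>2 * t, x) * \<psi> (snd x)) \<in> borel_measurable borel" by measurable
          then show ?thesis
            unfolding F_def using scaling_integral(1)[OF scaling_plane[OF s] m] by (simp add: mult.assoc)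
        qed
        finally show "F t = F (s\<^sup>2 * t)" .
      qed
    qed
  qed
  have lim: "(F \<longlongrightarrow> L) (inf (at_right 0) (ae_filter lborel))"
    using adm \<psi>_snd unfolding admissible_solution_def F_def L_def by blast
  have close: "AE t in lborel. 0 < t \<longrightarrow> t < real n \<longrightarrow> dist (F t) L < inverse (real (Suc n))" for n
  proof -
    have "eventually (\<lambda>t. dist (F t) L < inverse (real (Suc n))) (inf (at_right 0) (ae_filter lborel))"
      by (rule tendstoD[OF lim]) simp
    then obtain \<delta> where \<delta>: "\<delta> > 0" "AE t in lborel. 0 < t \<longrightarrow> t < \<delta> \<longrightarrow> dist (F t) L < inverse (real (Suc n))"
      unfolding eventually_ess_at_right by blast
    \<comment> \<open>For t < n this gives s^2 t < \<open>\<delta>\<close>; dividing by n + 1 avoids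
      the division by zero at n = 0.\<close>
    define s where "s = sqrt (\<delta> / real (Suc n))"
    have s: "s > 0" "s\<^sup>2 = \<delta> / real (Suc n)" using \<delta>(1) by (auto simp: s_def)
    have s2: "s\<^sup>2 > 0" using s(1) by (rule zero_less_power)
    show ?thesis
      using inv[OF s(1)] scaling_AE[OF scaling_real[OF s2] \<delta>(2)]
    proof eventually_elim
      case (elim t)
      have "s\<^sup>2 * t < \<delta>" if "0 < t" "t < real n"
      proof -
        have "\<delta> * t < \<delta> * real (Suc n)" using that \<delta>(1) by (intro mult_strict_left_mono) auto
        then show ?thesis unfolding s(2) by (simp add: field_simps)
      qed
      then show ?case using elim s2 by auto
    qed
  qed
  then have "AE t in lborel. \<forall>n. 0 < t \<longrightarrow> t < real n \<longrightarrow> dist (F t) L < inverse (real (Suc n))"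
    by (subst AE_all_countable) blast
  then show ?thesis
    unfolding F_def[symmetric] L_def[symmetric]
  proof eventually_elim
    case (elim t)
    show ?case
    proof
      assume "0 < t"
      show "F t = L"
      proof (rule ccontr)
        assume "F t \<noteq> L"
        then obtain n1 where n1: "inverse (real (Suc n1)) < dist (F t) L"
          using reals_Archimedean[of "dist (F t) L"] by auto
        \<comment> \<open>n1 makes the error too small for F t \<noteq> L, and n2 makes the interval
          reach t; their maximum does both.\<close>
        obtain n2 where "t < real n2" using reals_Archimedean2 by blast
        then have "dist (F t) L < inverse (real (Suc (max n1 n2)))"
          using elim[rule_format, of "max n1 n2"] \<open>0 < t\<close> by auto
        also have "\<dots> \<le> inverse (real (Suc n1))" by (simp add: le_imp_inverse_le)
        finally show False using n1 by simp
      qed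
    qed
  qed
qed

section \<open>Sign of the Kruzhkov solutions\<close>

text \<open>Tonelli: the L1 norms of the slices are bounded by C on a time interval of finite
  length.\<close>

lemma integrable_on_strip:
  assumes m: "set_borel_measurable lborel half_space u" and ab: "0 \<le> a" "a \<le> b"
    and L1: "AE t in lborel. a < t \<longrightarrow> t < b \<longrightarrow>
      integrable lborel (\<lambda>x. u (t, x)) \<and> (LINT x|lborel. \<bar>u (t, x)\<bar>) \<le> C"
  shows "integrable lborel (on_strip a b u)"
proof (rule integrableI_bounded)
  have "(\<lambda>z. indicator (strip a b) z * (indicator half_space z *\<^sub>R u z)) \<in> borel_measurable borel"
    using m by (intro borel_measurable_times) (auto simp: set_borel_measurable_def)
  moreover have "on_strip a b u = (\<lambda>z. indicator (strip a b) z * (indicator half_space z *\<^sub>R u z))"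
    using ab by (auto simp: fun_eq_iff on_strip_def strip_def half_space_def indicator_def)
  ultimately have w[measurable]: "on_strip a b u \<in> borel_measurable borel" by simp
  then show "on_strip a b u \<in> borel_measurable lborel" by simp
  have "(\<integral>\<^sup>+z. ennreal (norm (on_strip a b u z)) \<partial>lborel)
    = (\<integral>\<^sup>+t. (\<integral>\<^sup>+x. ennreal (norm (on_strip a b u (t, x))) \<partial>lborel) \<partial>lborel)"
    by (subst lborel.nn_integral_fst) (simp_all add: lborel_prod)
  also have "\<dots> \<le> (\<integral>\<^sup>+t. ennreal C * indicator {a<..<b} t \<partial>lborel)"
  proof (rule nn_integral_mono_AE)
    show "AE t in lborel. (\<integral>\<^sup>+x. ennreal (norm (on_strip a b u (t, x))) \<partial>lborel)
        \<le> ennreal C * indicator {a<..<b} t"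
      using L1
    proof eventually_elim
      case (elim t)
      show ?case
      proof (cases "a < t \<and> t < b")
        case True
        then have "integrable lborel (\<lambda>x. \<bar>u (t, x)\<bar>)" "(LINT x|lborel. \<bar>u (t, x)\<bar>) \<le> C"
          using elim by auto
        then show ?thesis
          using True by (simp add: on_strip_def strip_def nn_integral_eq_integral ennreal_leI)
      next
        case False
        then show ?thesis by (auto simp: on_strip_def strip_def)
      qed
    qed
  qed
  also have "\<dots> = ennreal C * emeasure lborel {a<..<b}"
    by (simp add: nn_integral_cmult_indicator)
  also have "\<dots> < \<infinity>" using ab by (simp add: ennreal_mult_less_top)
  finally show "(\<integral>\<^sup>+z. ennreal (norm (on_strip a b u z)) \<partial>lborel) < \<infinity>" .
qed

lemma integral_slices:
  fixes f :: "real \<times> real \<times> real \<Rightarrow> real"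
  assumes "integrable lborel f"
  shows "integrable lborel (\<lambda>t. LINT x|lborel. f (t, x))"
    and "(LINT z|lborel. f z) = (LINT t|lborel. LINT x|lborel. f (t, x))"
proof -
  have i: "integrable (lborel \<Otimes>\<^sub>M lborel) f" unfolding lborel_prod by (rule assms)
  show "integrable lborel (\<lambda>t. LINT x|lborel. f (t, x))"
    by (rule lborel_pair.integrable_fst'[OF i])
  show "(LINT z|lborel. f z) = (LINT t|lborel. LINT x|lborel. f (t, x))"
    using lborel_pair.integral_fst'[OF i] unfolding lborel_prod by simp
qed

text \<open>Continuity in time with values in L1 makes the norm continuous, hence bounded on [0,T].
  This gives integrability on a strip that starts at t = 0.\<close>

lemma kruzhkov_solution_L1_bounded:
  assumes u: "kruzhkov_solution b u"
  obtains C where "\<And>t. 0 \<le> t \<Longrightarrow> t \<le> T \<Longrightarrow> (LINT x|lborel. \<bar>u (t, x)\<bar>) \<le> C"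
proof -
  define N where "N t = (LINT x|lborel. \<bar>u (t, x)\<bar>)" for t
  have i: "integrable lborel (\<lambda>x. u (t, x))" if "t \<ge> 0" for t
    using u that by (simp add: kruzhkov_solution_def)
  have dist: "dist (N t) (N s) \<le> (LINT x|lborel. \<bar>u (t, x) - u (s, x)\<bar>)" if "t \<ge> 0" "s \<ge> 0" for t s
  proof -
    have "N t - N s = (LINT x|lborel. \<bar>u (t, x)\<bar> - \<bar>u (s, x)\<bar>)"
      unfolding N_def using i that by (subst Bochner_Integration.integral_diff) auto
    also have "\<bar>\<dots>\<bar> \<le> (LINT x|lborel. \<bar>\<bar>u (t, x)\<bar> - \<bar>u (s, x)\<bar>\<bar>)"
      by (rule integral_abs_bound)
    also have "\<dots> \<le> (LINT x|lborel. \<bar>u (t, x) - u (s, x)\<bar>)"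
      by (rule integral_mono) (use i that in auto)
    finally show ?thesis by (simp add: dist_real_def)
  qed
  have "continuous_on {0..} N"
    unfolding continuous_on_def
  proof
    fix s :: real assume "s \<in> {0..}"
    then have "((\<lambda>t. LINT x|lborel. \<bar>u (t, x) - u (s, x)\<bar>) \<longlongrightarrow> 0) (at s within {0..})"
      using u by (simp add: kruzhkov_solution_def)
    then have "((\<lambda>t. dist (N t) (N s)) \<longlongrightarrow> 0) (at s within {0..})"
      by (rule tendsto_sandwich[OF _ _ tendsto_const, rotated 2])
        (use dist \<open>s \<in> {0..}\<close> in \<open>auto simp: eventually_at_filter\<close>)
    then show "(N \<longlongrightarrow> N s) (at s within {0..})" by (rule tendsto_dist_iff[THEN iffD2])
  qed
  then have "compact (N ` {0..T})"
    by (intro compact_continuous_image) (auto intro: continuous_on_subset)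
  then have "bounded (N ` {0..T})" by (rule compact_imp_bounded)
  then obtain C where "\<forall>y\<in>N ` {0..T}. norm y \<le> C" unfolding bounded_iff by blast
  then have "norm (N t) \<le> C" if "0 \<le> t" "t \<le> T" for t using that by simp
  then have "N t \<le> C" if "0 \<le> t" "t \<le> T" for t using that by (simp add: abs_le_iff)
  then show ?thesis using that unfolding N_def by blast
qed

context smooth_step
begin

lemma kruzhkov_strip_solution:
  assumes u: "kruzhkov_solution b u" and "0 \<le> T"
  obtains C where "strip_solution P B u 0 T C"
proof -
  obtain C1 where C1: "\<And>t. 0 \<le> t \<Longrightarrow> t \<le> T \<Longrightarrow> (LINT x|lborel. \<bar>u (t, x)\<bar>) \<le> C1"
    using kruzhkov_solution_L1_bounded[OF u] by blast
  obtain C where C: "AE z in lborel. z \<in> half_space \<longrightarrow> \<bar>u z\<bar> \<le> C"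
    using u unfolding kruzhkov_solution_def by blast
  show ?thesis
  proof (rule that[of "max 0 C"], unfold_locales)
    show "entropy_solution u" using u by (simp add: kruzhkov_solution_def)
    then have "set_borel_measurable lborel half_space u" by (simp add: entropy_solution_def)
    then show "integrable lborel (on_strip 0 T u)"
      by (rule integrable_on_strip[where C = C1])
        (use u C1 \<open>0 \<le> T\<close> in \<open>auto simp: kruzhkov_solution_def\<close>)
    show "AE z in lborel. \<bar>on_strip 0 T u z\<bar> \<le> max 0 C"
      using C by eventually_elim (auto simp: on_strip_def strip_def half_space_def indicator_def)
  qed simp
qed

text \<open>The average of the negative part over times in [1,2] is compared with its average over
  times in [\<open>\<epsilon>\<close>, 2 \<open>\<epsilon>\<close>], which the continuity in L1
  bounds by the value at t = 0 plus e. The comparison is the decay inequality for the time weight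
  whose derivative is the difference of the two averaging kernels.\<close>

lemma kruzhkov_negative_part:
  assumes u: "kruzhkov_solution b u" and b: "integrable lborel b"
  shows "(\<integral>z. (\<bar>on_strip 0 3 u z\<bar> - on_strip 0 3 u z) * B (fst z) \<partial>lborel)
    \<le> (LINT x|lborel. \<bar>b x\<bar>) - (LINT x|lborel. b x)"
proof (rule field_le_epsilon)
  fix e :: real assume "e > 0"
  obtain C where "strip_solution P B u 0 3 C"
    using kruzhkov_strip_solution[OF u, of 3] by auto
  then interpret strip_solution P B u 0 3 C .
  obtain K where K: "K \<ge> 0" "\<And>x. \<bar>B x\<bar> \<le> K" using B_bounded by blast
  define M where "M = (LINT x|lborel. \<bar>b x\<bar>) - (LINT x|lborel. b x)"
  have i: "integrable lborel (\<lambda>x. u (t, x))" if "t \<ge> 0" for t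
    using u that by (simp add: kruzhkov_solution_def)
  have u0: "AE x in lborel. u (0, x) = b x" using u by (simp add: kruzhkov_solution_def)
  have "((\<lambda>t. LINT x|lborel. \<bar>u (t, x) - u (0, x)\<bar>) \<longlongrightarrow> 0) (at 0 within {0..})"
    using u by (simp add: kruzhkov_solution_def)
  from tendstoD[OF this, of "e / 2"] \<open>e > 0\<close>
  have "\<forall>\<^sub>F t in at 0 within {0..}. dist (LINT x|lborel. \<bar>u (t, x) - u (0, x)\<bar>) 0 < e / 2" by simp
  then obtain \<delta> where \<delta>: "\<delta> > 0" "\<And>t. t \<in> {0..} \<Longrightarrow> t \<noteq> 0 \<Longrightarrow> dist t 0 < \<delta> \<Longrightarrow>
      dist (LINT x|lborel. \<bar>u (t, x) - u (0, x)\<bar>) 0 < e / 2"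
    unfolding eventually_at by blast
  \<comment> \<open>The map r -> |r| - r is Lipschitz with constant 2; hence the e / 2
    above.\<close>
  have near: "(LINT x|lborel. \<bar>u (t, x)\<bar> - u (t, x)) \<le> M + e" if t: "0 < t" "t < \<delta>" for t
  proof -
    have "(LINT x|lborel. \<bar>u (t, x)\<bar> - u (t, x))
      \<le> (LINT x|lborel. (\<bar>u (0, x)\<bar> - u (0, x)) + 2 * \<bar>u (t, x) - u (0, x)\<bar>)"
    proof (rule integral_mono)
      show "\<bar>u (t, x)\<bar> - u (t, x) \<le> (\<bar>u (0, x)\<bar> - u (0, x)) + 2 * \<bar>u (t, x) - u (0, x)\<bar>" for x
        by (simp add: abs_if)
    qed (use i[of t] i[of 0] t in auto)
    also have "\<dots> = (LINT x|lborel. \<bar>u (0, x)\<bar> - u (0, x)) + 2 * (LINT x|lborel. \<bar>u (t, x) - u (0, x)\<bar>)"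
      using i[of t] i[of 0] t by (subst Bochner_Integration.integral_add) auto
    also have "(LINT x|lborel. \<bar>u (0, x)\<bar> - u (0, x)) = (LINT x|lborel. \<bar>b x\<bar> - b x)"
    proof (rule integral_cong_AE)
      show "AE x in lborel. \<bar>u (0, x)\<bar> - u (0, x) = \<bar>b x\<bar> - b x"
        using u0 by eventually_elim simp
      have [measurable]: "(\<lambda>x. u (0, x)) \<in> borel_measurable borel" "b \<in> borel_measurable borel"
        using i[of 0] b by auto
      show "(\<lambda>x. \<bar>u (0, x)\<bar> - u (0, x)) \<in> borel_measurable lborel" "(\<lambda>x. \<bar>b x\<bar> - b x) \<in> borel_measurable lborel"
        by measurable
    qed
    also have "\<dots> = M" unfolding M_def using b by (subst Bochner_Integration.integral_diff) auto
    finally show ?thesis using \<delta>(2)[of t] t by (simp add: dist_real_def)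
  qed
  \<comment> \<open>The bound 2 \<open>\<epsilon>\<close> <= \<open>\<delta>\<close> puts the early
    kernel where the estimate near t = 0 applies; \<open>\<epsilon>\<close> <= 1 makes
    \<open>P (t / \<epsilon>)\<close> at least \<open>P t\<close>, so that the weight below is
    nonnegative. The terms \<open>+ 0\<close> and the factor 1 in that weight match
    \<open>P_affine_deriv\<close>.\<close>
  define \<epsilon> where "\<epsilon> = min 1 (\<delta> / 2)"
  have \<epsilon>: "0 < \<epsilon>" "\<epsilon> \<le> 1" "2 * \<epsilon> \<le> \<delta>" using \<delta>(1) by (auto simp: \<epsilon>_def)
  define \<alpha> where "\<alpha> t = P (inverse \<epsilon> * t + 0) - P (1 * t + 0)" for t
  have \<alpha>_deriv: "(\<alpha> has_real_derivative B (inverse \<epsilon> * t + 0) * inverse \<epsilon> - B (1 * t + 0) * 1) (at t)" for t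
    unfolding \<alpha>_def[abs_def] by (intro DERIV_diff P_affine_deriv)
  have d\<alpha>: "deriv \<alpha> t = inverse \<epsilon> * B (inverse \<epsilon> * t) - B t" for t
    using DERIV_imp_deriv[OF \<alpha>_deriv] by simp
  define \<eta> where "\<eta> z = \<bar>w z\<bar> - w z" for z
  have \<eta>: "integrable lborel \<eta>" unfolding \<eta>_def[abs_def] using integrable_strip by auto
  have scale: "t \<le> inverse \<epsilon> * t" if "t \<ge> 0" for t
    using that \<epsilon> mult_right_mono[of 1 "inverse \<epsilon>" t] by (simp add: one_le_inverse)
  have "0 \<le> (\<integral>z. \<eta> z * deriv \<alpha> (fst z) \<partial>lborel)"
    unfolding \<eta>_def
  proof (rule negative_part_decay)
    show "smooth \<alpha>" unfolding \<alpha>_def[abs_def] by (intro smooth_diff smooth_affine smooth_P)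
    show "0 \<le> \<alpha> t" for t
      using P_mono[OF scale[of t]] P_left[of t] P_nonneg by (cases "t \<ge> 0") (auto simp: \<alpha>_def)
    show "\<alpha> t = 0" if "t \<notin> {\<epsilon>..2}" for t
    proof (cases "t < \<epsilon>")
      case True
      then have "inverse \<epsilon> * t \<le> 1" using \<epsilon> by (simp add: field_simps)
      then show ?thesis using True \<epsilon> by (simp add: \<alpha>_def P_left)
    next
      case False
      then have t: "t > 2" using that by auto
      have "2 \<le> inverse \<epsilon> * t" using scale[of t] t by linarith
      then show ?thesis using t by (simp add: \<alpha>_def P_right)
    qed
    show "0 < \<epsilon>" by fact
  qed simp
  also have "(\<integral>z. \<eta> z * deriv \<alpha> (fst z) \<partial>lborel)
    = (\<integral>z. \<eta> z * (inverse \<epsilon> * B (inverse \<epsilon> * fst z)) \<partial>lborel) - (\<integral>z. \<eta> z * B (fst z) \<partial>lborel)"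
  proof -
    have [measurable]: "(\<lambda>z::real \<times> real \<times> real. fst z) \<in> borel_measurable borel"
      by (intro borel_measurable_continuous_onI continuous_intros)
    have "integrable lborel (\<lambda>z. \<eta> z * (inverse \<epsilon> * B (inverse \<epsilon> * fst z)))"
      by (rule integrable_mult_bounded[OF \<eta>, where D = "inverse \<epsilon> * K"])
        (use K \<epsilon> in \<open>auto simp: abs_mult intro!: mult_left_mono\<close>)
    moreover have "integrable lborel (\<lambda>z. \<eta> z * B (fst z))"
      by (rule integrable_mult_bounded[OF \<eta>, where D = K]) (use K in auto)
    ultimately show ?thesis by (simp add: d\<alpha> right_diff_distrib)
  qed
  finally have le: "(\<integral>z. \<eta> z * B (fst z) \<partial>lborel) \<le> (\<integral>z. \<eta> z * (inverse \<epsilon> * B (inverse \<epsilon> * fst z)) \<partial>lborel)"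
    by simp
  have \<eta>B: "integrable lborel (\<lambda>z. \<eta> z * (inverse \<epsilon> * B (inverse \<epsilon> * fst z)))"
  proof (rule integrable_mult_bounded[OF \<eta>, where D = "inverse \<epsilon> * K"])
    have [measurable]: "(\<lambda>z::real \<times> real \<times> real. fst z) \<in> borel_measurable borel"
      by (intro borel_measurable_continuous_onI continuous_intros)
    show "(\<lambda>z::real \<times> real \<times> real. inverse \<epsilon> * B (inverse \<epsilon> * fst z)) \<in> borel_measurable lborel"
      by simp
  qed (use K \<epsilon> in \<open>auto simp: abs_mult intro!: mult_left_mono\<close>)
  have iB: "integrable lborel (\<lambda>t. inverse \<epsilon> * B (inverse \<epsilon> * t))"
    and intB: "(\<integral>t. inverse \<epsilon> * B (inverse \<epsilon> * t) \<partial>lborel) = 1"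
  proof -
    have s: "scaling (inverse \<epsilon>) (\<lambda>t. inverse \<epsilon> * t)" using \<epsilon> by (intro scaling_real) simp
    show "integrable lborel (\<lambda>t. inverse \<epsilon> * B (inverse \<epsilon> * t))"
      using scaling_integral(2)[OF s borel_measurable_B] integral_B by simp
    show "(\<integral>t. inverse \<epsilon> * B (inverse \<epsilon> * t) \<partial>lborel) = 1"
      using scaling_integral(1)[OF s borel_measurable_B] integral_B by simp
  qed
  have "(\<integral>z. \<eta> z * (inverse \<epsilon> * B (inverse \<epsilon> * fst z)) \<partial>lborel)
    = (LINT t|lborel. LINT x|lborel. \<eta> (t, x) * (inverse \<epsilon> * B (inverse \<epsilon> * fst (t, x))))"
    by (rule integral_slices(2)[OF \<eta>B])
  \<comment> \<open>The kernel is nonnegative with integral 1 and lives on times between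
    \<open>\<epsilon>\<close> and 2 \<open>\<epsilon>\<close>, so averaging preserves the bound M +
    e.\<close>
  also have "\<dots> \<le> (LINT t|lborel. (M + e) * (inverse \<epsilon> * B (inverse \<epsilon> * t)))"
  proof (rule integral_mono)
    show "integrable lborel (\<lambda>t. LINT x|lborel. \<eta> (t, x) * (inverse \<epsilon> * B (inverse \<epsilon> * fst (t, x))))"
      by (rule integral_slices(1)[OF \<eta>B])
    show "integrable lborel (\<lambda>t. (M + e) * (inverse \<epsilon> * B (inverse \<epsilon> * t)))"
      using iB by (rule integrable_mult_right)
    fix t
    show "(LINT x|lborel. \<eta> (t, x) * (inverse \<epsilon> * B (inverse \<epsilon> * fst (t, x))))
      \<le> (M + e) * (inverse \<epsilon> * B (inverse \<epsilon> * t))"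
    proof (cases "1 < inverse \<epsilon> * t \<and> inverse \<epsilon> * t < 2")
      case True
      then have t: "\<epsilon> < t" "t < 2 * \<epsilon>" using \<epsilon> by (auto simp: field_simps)
      then have "0 < t" "t < \<delta>" "t < 3" using \<epsilon> by auto
      then have "(LINT x|lborel. \<eta> (t, x)) = (LINT x|lborel. \<bar>u (t, x)\<bar> - u (t, x))"
        by (simp add: \<eta>_def on_strip_def strip_def)
      also have "\<dots> \<le> M + e" using near \<open>0 < t\<close> \<open>t < \<delta>\<close> by blast
      finally have "(LINT x|lborel. \<eta> (t, x)) * (inverse \<epsilon> * B (inverse \<epsilon> * t))
          \<le> (M + e) * (inverse \<epsilon> * B (inverse \<epsilon> * t))"
        by (rule mult_right_mono) (use \<epsilon> B_nonneg in simp)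
      then show ?thesis by simp
    qed (simp add: B_zero)
  qed
  also have "\<dots> = M + e" by (subst Bochner_Integration.integral_mult_right_zero) (simp only: intB mult_1_right)
  finally show "(\<integral>z. (\<bar>on_strip 0 3 u z\<bar> - on_strip 0 3 u z) * B (fst z) \<partial>lborel)
    \<le> (LINT x|lborel. \<bar>b x\<bar>) - (LINT x|lborel. b x) + e"
    using le unfolding M_def \<eta>_def by simp
qed

text \<open>In contrast to \<open>cutoff\<close>, the step is compressed by the factor n. As P
  vanishes up to 1, the transitions stay inside (c,d) and the limit is the indicator of the open
  interval.\<close>

definition box_cutoff :: "nat \<Rightarrow> real \<Rightarrow> real \<Rightarrow> real \<Rightarrow> real" where
  "box_cutoff n c d x = P (real n * (x - c)) * P (real n * (d - x))"

lemma smooth_box_cutoff: "smooth (box_cutoff n c d)"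
  using smooth_mult[OF smooth_affine[OF smooth_P, of "real n" "- real n * c"]
      smooth_affine[OF smooth_P, of "- real n" "real n * d"]]
  by (simp add: box_cutoff_def[abs_def] algebra_simps)

lemma box_cutoff_bounds: "0 \<le> box_cutoff n c d x" "box_cutoff n c d x \<le> 1"
  by (auto simp: box_cutoff_def P_nonneg P_le_1 mult_le_one)

lemma box_cutoff_support: "x \<notin> {c..d} \<Longrightarrow> box_cutoff n c d x = 0"
  using P_left[of "real n * (x - c)"] P_left[of "real n * (d - x)"]
    mult_nonneg_nonpos[of "real n" "x - c"] mult_nonneg_nonpos[of "real n" "d - x"]
  by (cases "x < c") (auto simp: box_cutoff_def)

lemma P_tendsto: "(\<lambda>n. P (real n * y)) \<longlonglongrightarrow> indicator {0<..} y"
proof (rule tendsto_eventually, cases "0 < y")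
  case True
  obtain N where "2 / y < real N" using reals_Archimedean2 by blast
  then have "2 \<le> real n * y" if "n \<ge> N" for n
    using True that by (simp add: field_simps) (smt (verit) mult_left_mono of_nat_le_iff)
  then show "\<forall>\<^sub>F n in sequentially. P (real n * y) = indicator {0<..} y"
    using True P_right eventually_sequentially by auto
next
  case False
  then have "real n * y \<le> 1" for n
    using mult_nonneg_nonpos[of "real n" y] by simp
  then show "\<forall>\<^sub>F n in sequentially. P (real n * y) = indicator {0<..} y"
    using False P_left by simp
qed

lemma box_cutoff_tendsto: "(\<lambda>n. box_cutoff n c d x) \<longlonglongrightarrow> indicator {c<..<d} x"
proof -
  have "indicator {c<..<d} x = indicator {0<..} (x - c) * (indicator {0<..} (d - x) :: real)"
    by (auto simp: indicator_def)
  then show ?thesis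
    unfolding box_cutoff_def by (auto intro!: tendsto_mult P_tendsto)
qed

end

section \<open>Vanishing of the limit\<close>

lemma box_spacetime:
  "z \<in> box l r \<longleftrightarrow> fst l < fst z \<and> fst z < fst r \<and> fst (snd l) < fst (snd z) \<and> fst (snd z) < fst (snd r)
     \<and> snd (snd l) < snd (snd z) \<and> snd (snd z) < snd (snd r)"
  for z l r :: "real \<times> real \<times> real"
proof -
  have B: "(Basis :: (real \<times> real \<times> real) set) = {(1, 0, 0), (0, 1, 0), (0, 0, 1)}"
    by (auto simp: Basis_prod_def zero_prod_def)
  show ?thesis by (auto simp: mem_box B inner_prod_def)
qed

context smooth_step
begin

text \<open>Smooth approximations of B(t) times the indicator of \<open>box l r\<close>. The factor
  B keeps the support away from t = 0 for every box, and the domination by B is what allows the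
  estimate of the negative part to be used.\<close>

definition strip_test :: "nat \<Rightarrow> real \<times> real \<times> real \<Rightarrow> real \<times> real \<times> real \<Rightarrow> real \<times> real \<times> real \<Rightarrow> real" where
  "strip_test n l r = tensor (\<lambda>t. B t * box_cutoff n (fst l) (fst r) t)
     (box_cutoff n (fst (snd l)) (fst (snd r))) (box_cutoff n (snd (snd l)) (snd (snd r)))"

lemma test_function_strip_test: "test_function (strip_test n l r)"
  unfolding strip_test_def
  by (rule test_function_tensor[OF smooth_mult[OF smooth_B smooth_box_cutoff] smooth_box_cutoff
        smooth_box_cutoff _ _ box_cutoff_support box_cutoff_support, of 1 2])
    (auto simp: B_zero)

lemma strip_test_bounds: "0 \<le> strip_test n l r z" "strip_test n l r z \<le> B (fst z)"
proof -
  show "0 \<le> strip_test n l r z"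
    by (simp add: strip_test_def tensor_def box_cutoff_bounds B_nonneg)
  have "B (fst z) * box_cutoff n (fst l) (fst r) (fst z) * box_cutoff n (fst (snd l)) (fst (snd r)) (fst (snd z))
      * box_cutoff n (snd (snd l)) (snd (snd r)) (snd (snd z)) \<le> B (fst z) * 1 * 1 * 1"
    by (intro mult_mono mult_nonneg_nonneg B_nonneg box_cutoff_bounds) auto
  then show "strip_test n l r z \<le> B (fst z)"
    by (simp add: strip_test_def tensor_def)
qed

lemma strip_test_tendsto: "(\<lambda>n. strip_test n l r z) \<longlonglongrightarrow> B (fst z) * indicator (box l r) z"
proof -
  have "indicator (box l r) z = indicator {fst l<..<fst r} (fst z) * indicator {fst (snd l)<..<fst (snd r)} (fst (snd z))
      * (indicator {snd (snd l)<..<snd (snd r)} (snd (snd z)) :: real)"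
    by (auto simp: indicator_def box_spacetime)
  then have eq: "B (fst z) * indicator (box l r) z = B (fst z) * indicator {fst l<..<fst r} (fst z)
      * indicator {fst (snd l)<..<fst (snd r)} (fst (snd z)) * indicator {snd (snd l)<..<snd (snd r)} (snd (snd z))"
    by simp
  show ?thesis
    unfolding eq strip_test_def tensor_def by (intro tendsto_intros box_cutoff_tendsto)
qed

lemma strip_test_measurable[measurable]: "strip_test n l r \<in> borel_measurable borel"
  using test_function_strip_test[of n l r]
  by (intro borel_measurable_continuous_onI smooth_imp_continuous test_function_imp_smooth)

lemma strip_test_integral:
  assumes "0 \<le> a" "a \<le> 1" "2 \<le> b"
  shows "(LINT z:half_space|lborel. u z * strip_test n l r z) = (\<integral>z. on_strip a b u z * strip_test n l r z \<partial>lborel)"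
  unfolding set_lebesgue_integral_def
proof (rule Bochner_Integration.integral_cong[OF refl])
  fix z
  have "strip_test n l r z = 0" if "\<not> (1 < fst z \<and> fst z < 2)"
    using that by (simp add: strip_test_def tensor_def B_zero)
  then show "indicator half_space z *\<^sub>R (u z * strip_test n l r z) = on_strip a b u z * strip_test n l r z"
    using assms by (cases "1 < fst z \<and> fst z < 2"; cases z) (auto simp: on_strip_def strip_def half_space_def)
qed

text \<open>For each m the tested value is at least minus the B-average of |u_m| - u_m, hence at
  least minus the gap between L and the mass of the datum. This gap tends to 0, and the linear
  tested value passes to the distributional limit.\<close>

lemma limit_test_nonneg:
  assumes u: "\<And>m. m \<ge> 1 \<Longrightarrow> kruzhkov_solution (b m) (v m)"
    and b: "\<And>m. m \<ge> 1 \<Longrightarrow> integrable lborel (b m)"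
      "\<And>m. m \<ge> 1 \<Longrightarrow> (LINT x|lborel. \<bar>b m x\<bar>) \<le> L" "(\<lambda>m. LINT x|lborel. b m x) \<longlonglongrightarrow> L"
    and lim: "distributional_limit v u"
  shows "0 \<le> (LINT z:half_space|lborel. u z * strip_test n l r z)"
proof (rule LIMSEQ_le)
  show "(\<lambda>m. LINT z:half_space|lborel. v m z * strip_test n l r z)
      \<longlonglongrightarrow> (LINT z:half_space|lborel. u z * strip_test n l r z)"
    using lim test_function_strip_test unfolding distributional_limit_def by blast
  show "(\<lambda>m. - (L - (LINT x|lborel. b m x))) \<longlonglongrightarrow> 0"
    using tendsto_minus[OF tendsto_diff[OF tendsto_const b(3), of L]] by simp
  have "- (L - (LINT x|lborel. b m x)) \<le> (LINT z:half_space|lborel. v m z * strip_test n l r z)" if m: "m \<ge> 1" for m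
  proof -
    obtain C where "strip_solution P B (v m) 0 3 C"
      using kruzhkov_strip_solution[OF u[OF m], of 3] by auto
    then interpret strip_solution P B "v m" 0 3 C .
    obtain K where K: "K \<ge> 0" "\<And>x. \<bar>B x\<bar> \<le> K" using B_bounded by blast
    have [measurable]: "(\<lambda>z::real \<times> real \<times> real. fst z) \<in> borel_measurable borel"
      by (intro borel_measurable_continuous_onI continuous_intros)
    have "\<bar>strip_test n l r z\<bar> \<le> K" for z
      using strip_test_bounds[of n l r z] K(2)[of "fst z"] by linarith
    then have i1: "integrable lborel (\<lambda>z. w z * strip_test n l r z)"
      by (intro integrable_mult_bounded[OF integrable_strip, where D = K]) auto
    have i2: "integrable lborel (\<lambda>z. (\<bar>w z\<bar> - w z) * B (fst z))"
      by (rule integrable_mult_bounded[where D = K]) (use K integrable_strip in auto)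
    have "- (L - (LINT x|lborel. b m x)) \<le> - (\<integral>z. (\<bar>w z\<bar> - w z) * B (fst z) \<partial>lborel)"
      using kruzhkov_negative_part[OF u[OF m] b(1)[OF m]] b(2)[OF m] by linarith
    also have "\<dots> = (\<integral>z. - ((\<bar>w z\<bar> - w z) * B (fst z)) \<partial>lborel)" by simp
    \<comment> \<open>Nonnegativity of |w| times the test function yields -(|w| - w) times the test
      function as a lower bound; the test function is then replaced by B, which dominates
      it.\<close>
    also have "\<dots> \<le> (\<integral>z. w z * strip_test n l r z \<partial>lborel)"
    proof (rule integral_mono)
      fix z
      have "(\<bar>w z\<bar> - w z) * strip_test n l r z \<le> (\<bar>w z\<bar> - w z) * B (fst z)"
        by (intro mult_left_mono strip_test_bounds) auto
      moreover have "0 \<le> \<bar>w z\<bar> * strip_test n l r z"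
        by (intro mult_nonneg_nonneg strip_test_bounds) auto
      ultimately show "- ((\<bar>w z\<bar> - w z) * B (fst z)) \<le> w z * strip_test n l r z"
        by (simp add: left_diff_distrib)
    qed (use i1 i2 in auto)
    also have "\<dots> = (LINT z:half_space|lborel. v m z * strip_test n l r z)"
      by (rule strip_test_integral[symmetric]) auto
    finally show ?thesis .
  qed
  then show "\<exists>N. \<forall>m\<ge>N. - (L - (LINT x|lborel. b m x)) \<le> (LINT z:half_space|lborel. v m z * strip_test n l r z)"
    by blast
qed

end

context strip_solution
begin

text \<open>The tests increase their resolution to indicators of boxes by dominated convergence,
  after which the criterion on box integrals gives the sign almost everywhere.\<close>

lemma nonneg_of_tests:
  assumes ab: "a \<le> 1" "2 \<le> b"
    and test: "\<And>n l r. 0 \<le> (LINT z:half_space|lborel. u z * strip_test n l r z)"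
  shows "AE z in lborel. 0 \<le> w z * B (fst z)"
proof (rule AE_nonneg_of_box_integrals)
  obtain K where K: "K \<ge> 0" "\<And>x. \<bar>B x\<bar> \<le> K" using B_bounded by blast
  have [measurable]: "(\<lambda>z::real \<times> real \<times> real. fst z) \<in> borel_measurable borel"
    by (intro borel_measurable_continuous_onI continuous_intros)
  show "integrable lborel (\<lambda>z. w z * B (fst z))"
    by (rule integrable_mult_bounded[OF integrable_strip, where D = K]) (use K in auto)
  fix l r :: "real \<times> real \<times> real"
  have "\<bar>strip_test n l r z\<bar> \<le> K" for n z
    using strip_test_bounds[of n l r z] K(2)[of "fst z"] by linarith
  then have "(\<lambda>n. \<integral>z. w z * strip_test n l r z \<partial>lborel)
      \<longlonglongrightarrow> (\<integral>z. w z * (B (fst z) * indicator (box l r) z) \<partial>lborel)"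
    by (intro integral_mult_bounded_tendsto[OF integrable_strip, where D = K] strip_test_tendsto) auto
  moreover have "0 \<le> (\<integral>z. w z * strip_test n l r z \<partial>lborel)" for n
    using test[of n l r] strip_test_integral[OF a_nonneg ab] by simp
  ultimately have "0 \<le> (\<integral>z. w z * (B (fst z) * indicator (box l r) z) \<partial>lborel)"
    by (intro LIMSEQ_le_const) auto
  then show "0 \<le> (\<integral>z. indicator (box l r) z * (w z * B (fst z)) \<partial>lborel)"
    by (simp add: mult_ac)
qed

text \<open>With B as time weight the first term of the conservation law is a constant times the
  integral of B', hence 0. What remains is the integral of the nonnegative function w^3 B(t)
  \<open>\<psi>'(x2)\<close> / 3, which must therefore vanish almost everywhere.\<close>

lemma zero_of_stationary_marginals:
  assumes ab: "a < 1" "2 < b"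
    and nonneg: "AE z in lborel. 0 \<le> w z * B (fst z)"
    and marg: "\<And>\<psi>. continuous_on UNIV \<psi> \<Longrightarrow> bounded (range \<psi>) \<Longrightarrow>
      \<exists>L. AE t in lborel. 0 < t \<longrightarrow> (LINT x|lborel. u (t, x) * \<psi> (snd x)) = L"
  shows "AE z in lborel. 1 < fst z \<longrightarrow> fst z < 2 \<longrightarrow> u z = 0"
proof -
  have "AE z in lborel. 1 < fst z \<longrightarrow> fst z < 2 \<longrightarrow> \<bar>snd (snd z)\<bar> < real (Suc n) \<longrightarrow> u z = 0" for n
  proof -
    define R where "R = real (Suc n)"
    have R: "R > 0" by (simp add: R_def)
    \<comment> \<open>The affine map sends (-R,R) onto (1,2), where B is positive. The derivative of
      this weight is thus positive exactly for |x2| < R, which is why a sequence of radii is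
      used.\<close>
    define \<psi> where "\<psi> x = P (inverse (2 * R) * x + 3 / 2)" for x
    have \<psi>_deriv: "(\<psi> has_real_derivative B (inverse (2 * R) * x + 3 / 2) * inverse (2 * R)) (at x)" for x
      unfolding \<psi>_def[abs_def] by (rule P_affine_deriv)
    have d\<psi>: "deriv \<psi> x = B (inverse (2 * R) * x + 3 / 2) * inverse (2 * R)" for x
      by (rule DERIV_imp_deriv[OF \<psi>_deriv])
    have \<psi>: "smooth \<psi>" unfolding \<psi>_def[abs_def] by (rule smooth_affine[OF smooth_P])
    have \<psi>_bound: "\<bar>\<psi> x\<bar> \<le> 1" for x by (simp add: \<psi>_def P_abs)
    obtain K where K: "K \<ge> 0" "\<And>x. \<bar>B x\<bar> \<le> K" using B_bounded by blast
    define D where "D = max 1 (K * inverse (2 * R))"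
    have D: "\<bar>\<psi> x\<bar> \<le> D" "\<bar>deriv \<psi> x\<bar> \<le> D" for x
    proof -
      show "\<bar>\<psi> x\<bar> \<le> D" using \<psi>_bound[of x] by (simp add: D_def)
      have "\<bar>deriv \<psi> x\<bar> \<le> K * inverse (2 * R)"
        using R K(2) by (simp add: d\<psi> abs_mult divide_right_mono field_simps)
      then show "\<bar>deriv \<psi> x\<bar> \<le> D" by (simp add: D_def)
    qed
    note law = conservation_law[OF smooth_B B_support ab \<psi> D]
    note weight = integrable_weight[OF smooth_B B_support ab \<psi> D]
    have "bounded (range \<psi>)" using \<psi>_bound by (auto simp: bounded_iff)
    then obtain L where L: "AE t in lborel. 0 < t \<longrightarrow> (LINT x|lborel. u (t, x) * \<psi> (snd x)) = L"
      using marg[OF smooth_imp_continuous[OF \<psi>]] by blast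
    have dB: "deriv B t = 0" if "t \<notin> {1..2}" for t
      by (rule deriv_zero_outside[OF B_support that])
    have int_dB: "integrable lborel (deriv B)" "(\<integral>t. deriv B t \<partial>lborel) = 0"
      using deriv_lborel_integral[OF smooth_realD(1)[OF smooth_B] smooth_imp_continuous[OF smooth_realD(2)[OF smooth_B]] dB]
        B_zero[of 1] B_zero[of 2] by auto
    have i1: "integrable lborel (\<lambda>z. w z * (deriv B (fst z) * \<psi> (snd (snd z))))"
      by (rule weight(1)[OF _ integrable_strip])
    have i3: "integrable lborel (\<lambda>z. w z ^ 3 / 3 * (B (fst z) * deriv \<psi> (snd (snd z))))"
      by (rule weight(2)[OF _ integrable_flux(2)])
    have "(\<integral>z. w z * (deriv B (fst z) * \<psi> (snd (snd z))) \<partial>lborel)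
      = (LINT t|lborel. LINT x|lborel. w (t, x) * (deriv B t * \<psi> (snd x)))"
      using integral_slices(2)[OF i1] by simp
    \<comment> \<open>For almost every t the slice integral is B'(t) times the marginal, and the
      marginal is the constant L.\<close>
    also have "\<dots> = (LINT t|lborel. L * deriv B t)"
    proof (rule integral_cong_AE)
      show "(\<lambda>t. LINT x|lborel. w (t, x) * (deriv B t * \<psi> (snd x))) \<in> borel_measurable lborel"
        using integral_slices(1)[OF i1] by (simp add: borel_measurable_integrable)
      show "(\<lambda>t. L * deriv B t) \<in> borel_measurable lborel" using int_dB by auto
      show "AE t in lborel. (LINT x|lborel. w (t, x) * (deriv B t * \<psi> (snd x))) = L * deriv B t"
        using L
      proof eventually_elim
        case (elim t)
        show ?case
        proof (cases "t \<in> {1..2}")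
          case True
          then have "(t, x) \<in> strip a b" for x using ab by (auto simp: strip_def)
          then have "(LINT x|lborel. w (t, x) * (deriv B t * \<psi> (snd x)))
              = (LINT x|lborel. deriv B t * (u (t, x) * \<psi> (snd x)))"
            by (simp add: on_strip_def mult_ac)
          also have "\<dots> = deriv B t * L" using elim True by simp
          finally show ?thesis by simp
        qed (simp add: dB)
      qed
    qed
    also have "\<dots> = 0" using int_dB by simp
    finally have "(\<integral>z. w z ^ 3 / 3 * (B (fst z) * deriv \<psi> (snd (snd z))) \<partial>lborel) = 0"
      using law by simp
    moreover have "AE z in lborel. 0 \<le> w z ^ 3 / 3 * (B (fst z) * deriv \<psi> (snd (snd z)))"
      using nonneg
    proof eventually_elim
      case (elim z)
      \<comment> \<open>The known sign concerns w B, so one factor w is split off and the remaining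
        factors are nonnegative by themselves.\<close>
      have "w z ^ 3 / 3 * (B (fst z) * deriv \<psi> (snd (snd z)))
          = (w z * B (fst z)) * ((w z)\<^sup>2 / 3 * deriv \<psi> (snd (snd z)))"
        by (simp add: power2_eq_square power3_eq_cube)
      also have "\<dots> \<ge> 0"
        by (rule mult_nonneg_nonneg[OF elim]) (use R in \<open>simp add: d\<psi> B_nonneg\<close>)
      finally show ?case .
    qed
    ultimately have "AE z in lborel. w z ^ 3 / 3 * (B (fst z) * deriv \<psi> (snd (snd z))) = 0"
      using integral_nonneg_eq_0_iff_AE[OF i3] by simp
    then show ?thesis
    proof eventually_elim
      case (elim z)
      show ?case
      proof (intro impI)
        assume z: "1 < fst z" "fst z < 2" "\<bar>snd (snd z)\<bar> < real (Suc n)"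
        have "\<bar>inverse (2 * R) * snd (snd z)\<bar> < 1 / 2"
          using z(3) R by (simp add: R_def abs_mult field_simps)
        then have "deriv \<psi> (snd (snd z)) > 0"
          unfolding d\<psi> by (intro mult_pos_pos B_pos) (use R in auto)
        moreover have "B (fst z) > 0" using z B_pos by simp
        ultimately have "w z = 0" using elim by simp
        moreover have "z \<in> strip a b" using z ab by (cases z) (auto simp: strip_def)
        ultimately show "u z = 0" by (simp add: on_strip_def)
      qed
    qed
  qed
  then have "AE z in lborel. \<forall>n. 1 < fst z \<longrightarrow> fst z < 2 \<longrightarrow> \<bar>snd (snd z)\<bar> < real (Suc n) \<longrightarrow> u z = 0"
    by (subst AE_all_countable) blast
  then show ?thesis
  proof eventually_elim
    case (elim z)
    obtain n where "\<bar>snd (snd z)\<bar> < real n" using reals_Archimedean2 by blast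
    then have "\<bar>snd (snd z)\<bar> < real (Suc n)" by simp
    with elim show ?case by blast
  qed
qed

end

lemma nonzero_nonneg_pos:
  assumes "nonneg_signed_measure g" "nonzero_measure g"
  shows "0 < g UNIV"
proof -
  interpret nonneg_signed_measure g by fact
  obtain A where "A \<in> sets borel" "g A \<noteq> 0" using assms(2) by (auto simp: nonzero_measure_def)
  then show ?thesis using nonneg_value[of A] mono[of UNIV A] by auto
qed

theorem proposition5p2:
  fixes g :: "real set \<Rightarrow> real"
    and a :: "(real \<times> real) set \<Rightarrow> real"
    and u :: "real \<times> real \<times> real \<Rightarrow> real"
    and a_seq :: "nat \<Rightarrow> real \<times> real \<Rightarrow> real"
    and u_seq :: "nat \<Rightarrow> real \<times> real \<times> real \<Rightarrow> real"
  assumes "signed_measure g" and "nonzero_measure g"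
    and "a = axis_measure g"
    and "unique_admissible_solution a u"
    and "approximate_data a a_seq"
    and "\<And>m. m \<ge> 1 \<Longrightarrow> kruzhkov_solution (a_seq m) (u_seq m)"
    and "distributional_limit u_seq u"
    and "nonneg_measure g"
    and "(INF x\<in>measure_support g. ereal x) > -\<infinity>"
  shows "(SUP x\<in>measure_support g. ereal x) = \<infinity>"
proof -
  note g = \<open>signed_measure g\<close> \<open>nonneg_measure g\<close>
  have a: "a = axis_measure g" by fact
  define M where "M = g UNIV"
  interpret a: nonneg_signed_measure a
    unfolding a by (rule axis_measure_nonneg_signed[OF g])
  have "0 < M"
    unfolding M_def by (rule nonzero_nonneg_pos) (use g assms(2) nonneg_signed_measure.intro in auto)
  have aM: "a UNIV = M" by (simp add: a axis_measure_def M_def)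
  have unique: "unique_admissible_solution (axis_measure g) u" using assms(4) a by simp
  then have adm: "admissible_solution (axis_measure g) u"
    by (simp add: unique_admissible_solution_def)
  obtain P B :: "real \<Rightarrow> real" where PB:
    "smooth P" "smooth B" "\<And>x. (P has_real_derivative B x) (at x)"
    "\<And>x. x \<le> 1 \<Longrightarrow> P x = 0" "\<And>x. x \<ge> 2 \<Longrightarrow> P x = 1"
    "\<And>x. 1 < x \<Longrightarrow> x < 2 \<Longrightarrow> B x > 0" "\<And>x. \<not> (1 < x \<and> x < 2) \<Longrightarrow> B x = 0"
    using smooth_step_exists by blast
  interpret smooth_step P B by unfold_locales (fact PB)+
  have data: "m \<ge> 1 \<Longrightarrow> integrable lborel (a_seq m)"
    "m \<ge> 1 \<Longrightarrow> (LINT x|lborel. \<bar>a_seq m x\<bar>) \<le> M" for m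
    using assms(5) a.total_variation_eq aM by (auto simp: approximate_data_def L1_Linf_def)
  \<comment> \<open>The constant 1 is an admissible test for narrow convergence, so no mass is lost.
    Its limit M is also the bound on the L1 norms, which leaves no room for a negative part.\<close>
  have "(\<lambda>m. LINT x|lborel. a_seq m x * 1) \<longlonglongrightarrow> signed_integral a (\<lambda>_. 1)"
    using assms(5) unfolding approximate_data_def
    by (elim conjE allE[of _ "\<lambda>_. 1"] mp) (auto simp: bounded_iff)
  then have data_lim: "(\<lambda>m. LINT x|lborel. a_seq m x) \<longlonglongrightarrow> M"
    by (simp add: a.signed_integral_one aM)
  obtain C0 where C0: "AE z in lborel. 1 / 2 < fst z \<longrightarrow> \<bar>u z\<bar> \<le> C0"
    using adm unfolding admissible_solution_def entropy_solution_def by (metis half_gt_zero zero_less_one)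
  obtain C1 where C1: "AE t in lborel. 0 < t \<longrightarrow>
        integrable lborel (\<lambda>x. u (t, x)) \<and> (LINT x|lborel. \<bar>u (t, x)\<bar>) \<le> C1"
    using adm unfolding admissible_solution_def by blast
  interpret S: strip_solution P B u "1 / 2" 3 "max 0 C0"
  proof
    show "entropy_solution u" using adm by (simp add: admissible_solution_def)
    then have m: "set_borel_measurable lborel half_space u" by (simp add: entropy_solution_def)
    have "AE t in lborel. 1 / 2 < t \<longrightarrow> t < 3 \<longrightarrow>
        integrable lborel (\<lambda>x. u (t, x)) \<and> (LINT x|lborel. \<bar>u (t, x)\<bar>) \<le> C1"
      using C1 by eventually_elim auto
    then show "integrable lborel (on_strip (1 / 2) 3 u)"
      by (rule integrable_on_strip[OF m, rotated 2]) auto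
    show "AE z in lborel. \<bar>on_strip (1 / 2) 3 u z\<bar> \<le> max 0 C0"
      using C0 by eventually_elim (auto simp: on_strip_def strip_def indicator_def)
  qed simp
  have "AE z in lborel. 0 \<le> S.w z * B (fst z)"
    by (rule S.nonneg_of_tests) (use limit_test_nonneg[OF assms(6) data data_lim assms(7)] in auto)
  then have "AE z in lborel. 1 < fst z \<longrightarrow> fst z < 2 \<longrightarrow> u z = 0"
    by (rule S.zero_of_stationary_marginals[rotated 2]) (use marginal_constant[OF g unique] in auto)
  from AE_slices[OF this] have "AE t in lborel. 1 < t \<longrightarrow> t < 2 \<longrightarrow> (AE x in lborel. u (t, x) = 0)"
    by eventually_elim auto
  \<comment> \<open>The marginal for the weight 1 is the total mass, equal to M at almost every
    time.\<close>
  moreover have "AE t in lborel. 0 < t \<longrightarrow> (LINT x|lborel. u (t, x)) = M"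
    using marginal_constant[OF g unique, of "\<lambda>_. 1"] a.signed_integral_one aM
    by (simp add: a)
  ultimately have "AE t in lborel. \<not> (1 < t \<and> t < (2::real))"
  proof eventually_elim
    case (elim t)
    show ?case
    proof
      assume t: "1 < t \<and> t < 2"
      then have "(LINT x|lborel. u (t, x)) = 0" using elim(1) by (intro integral_eq_zero_AE) simp
      then show False using elim(2) t \<open>0 < M\<close> by simp
    qed
  qed
  \<comment> \<open>A property that fails at every t in (1,2) but holds almost everywhere would make
    this interval Lebesgue null.\<close>
  then have "emeasure lborel {t \<in> space lborel. \<not> \<not> (1 < t \<and> t < (2::real))} = 0"
    by (intro AE_iff_measurable[THEN iffD1, rotated 2]) auto
  moreover have "{t \<in> space lborel. \<not> \<not> (1 < t \<and> t < (2::real))} = {1<..<2}" by auto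
  ultimately have False by simp
  then show ?thesis ..
qed

end
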